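(* Let $n \geq 1$ be an integer and let $s$ be an even integer with $0 < s \leq \lfloor 2n/3 \rfloor$. Then \[ \vartheta(H(n,s)) = 2^n\,\frac{M_K^n(s) - |\mathbb{H}^n_s|^{-1}\,\vartheta(H(n,s)_0)}{M_K^n(s) - 1}. \]
   Context: Hamming cube. $\mathbb{H}^n = \{0,1\}^n$ with the Hamming distance $d(x,y)$ (number of positions in which $x$ and $y$ differ). The weight of $x\in\mathbb{H}^n$ is the number of 1s in it, and $\mathbb{H}^n_s$ is the set of words of weight $s$. Three distinct points $x_1,x_2,x_3 \in \mathbb{H}^n$ form an $s$-triangle if $d(x_i,x_j) = s$ for all $i \neq j$. $H(n,s)$ is the $3$-uniform hypergraph with vertex set $\mathbb{H}^n$ whose edges are all $s$-triangles. $H(n,s)_0$ is the link (defined below) of the all-zero word $0$ in $H(n,s)$; for $s$ as in the claim it is the graph with vertex set $\mathbb{H}^n_s$ in which two words are adjacent if they are at distance $s$. Krawtchouk polynomials. For integers $0\le k\le n$ and $t \in \{0,\dots,n\}$, $K^n_k(t) = \binom{n}{k}^{-1}\sum_{i=0}^k (-1)^i \binom{t}{i}\binom{n-t}{k-i}$ (so $K^n_k(0)=1$), and $M_K^n(s) = \min\{ K^n_k(s) : k = 0,\dots,n\}$. Theta number. For an integer $r \geq 1$, an $r$-uniform hypergraph $H=(V,E)$ consists of a finite set $V$ and a set $E$ of $r$-element subsets of $V$ (graphs are the case $r=2$). A set $I \subseteq V$ is independent if it contains no edge. $\mathrm{IND}(H) = \mathrm{conv}\{\chi_I \in \mathbb{R}^V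 : I \subseteq V \text{ independent}\}$, where $\chi_I$ is the characteristic function of $I$. For $r \geq 2$ and $x \in V$, the link of $x$ in $H$ is the $(r-1)$-uniform hypergraph $H_x$ with vertex set $V_x = \{ y \in V \setminus\{x\} : \text{there is } e \in E \text{ containing } x \text{ and } y\}$, in which an $(r-1)$-subset $e$ of $V_x$ is an edge if and only if $e \cup \{x\} \in E$. For $A \in \mathbb{R}^{V\times V}$, $A_x$ is the row indexed by $x$; $f[U]$ is the restriction of $f$ to $U$. Positive semidefinite matrices are always symmetric. For a symmetric matrix $A$ with diagonal $a$, write $R(A) = \begin{pmatrix} 1 & a^{\mathsf T} \\ a & A\end{pmatrix}$. The theta body is defined recursively: for $r = 1$, $\mathrm{TH}(H) = \mathrm{IND}(H)$; for $r \geq 2$, $\mathrm{TH}(H)$ is the set of all $f \in \mathbb{R}^V$ for which there is $F \in \mathbb{R}^{V \times V}$ such that $f = \mathrm{diag}\,F$, $F_x[V_x] \in F(x,x)\,\mathrm{TH}(H_x)$ for every $x \in V$ (no constraint on row $F_x$ if the link $H_x$ is empty), and $R(F)$ is positive semidefinite. $\vartheta(H) = \max\{ \sum_{x \in V} f(x) : f \in \mathrm{TH}(H)\}$. *)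

theory Defs
  imports "HOL-Analysis.Analysis"
begin

section \<open>Hypergraphs\<close>

type_synonym 'a hypergraph = "'a set \<times> 'a set set"

abbreviation verts :: "'a hypergraph \<Rightarrow> 'a set" where "verts \<equiv> fst"
abbreviation edges :: "'a hypergraph \<Rightarrow> 'a set set" where "edges \<equiv> snd"

definition uniform :: "nat \<Rightarrow> 'a hypergraph \<Rightarrow> bool" where
  "uniform r H \<longleftrightarrow> finite (verts H) \<and> (\<forall>e\<in>edges H. e \<subseteq> verts H \<and> card e = r)"

definition independent_in :: "'a hypergraph \<Rightarrow> 'a set \<Rightarrow> bool" where
  "independent_in H I \<longleftrightarrow> I \<subseteq> verts H \<and> \<not> (\<exists>e\<in>edges H. e \<subseteq> I)"

definition link_verts :: "'a hypergraph \<Rightarrow> 'a \<Rightarrow> 'a set" where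
  "link_verts H x = {y \<in> verts H - {x}. \<exists>e\<in>edges H. x \<in> e \<and> y \<in> e}"

text \<open>The edges of the link need no cardinality condition: \<open>x \<notin> link_verts H x\<close>, so an edge
  \<open>insert x e\<close> of an \<open>r\<close>-uniform \<open>H\<close> forces \<open>card e = r - 1\<close>; see \<open>uniform_link\<close>.\<close>

definition link :: "'a hypergraph \<Rightarrow> 'a \<Rightarrow> 'a hypergraph" where
  "link H x = (link_verts H x, {e. e \<subseteq> link_verts H x \<and> insert x e \<in> edges H})"

lemma uniform_link:
  assumes "uniform r H"
  shows "uniform (r - 1) (link H x)"
proof -
  have fin: "finite (link_verts H x)"
    using assms by (auto simp: uniform_def link_verts_def)
  have "card e = r - 1" if "e \<subseteq> link_verts H x" "insert x e \<in> edges H" for e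
  proof -
    have "finite e" "x \<notin> e"
      using that(1) fin finite_subset by (auto simp: link_verts_def)
    moreover have "card (insert x e) = r"
      using assms that(2) by (auto simp: uniform_def)
    ultimately show ?thesis by auto
  qed
  with fin show ?thesis
    by (auto simp: uniform_def link_def)
qed


section \<open>Theta body and theta number\<close>

text \<open>A vector in \<open>\<real>\<^sup>V\<close>, for \<open>V :: 'a set\<close>, is a function of type \<open>'a \<Rightarrow> real\<close> that vanishes outside
  \<open>V\<close>. In particular, the characteristic function of \<open>I \<subseteq> V\<close> is \<open>indicator I\<close>.
  Function spaces are not an instance of \<^class>\<open>real_vector\<close>, so \<open>convex hull\<close> does not apply to
  them; \<open>conv S\<close> consists of the finite convex combinations of elements of \<open>S\<close>,
  as in \<open>convex_hull_explicit\<close>.\<close>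

definition conv :: "('a \<Rightarrow> real) set \<Rightarrow> ('a \<Rightarrow> real) set" where
  "conv S = {\<lambda>x. \<Sum>g\<in>T. u g * g x | T u.
     finite T \<and> T \<subseteq> S \<and> (\<forall>g\<in>T. 0 \<le> u g) \<and> sum u T = 1}"

definition IND :: "'a hypergraph \<Rightarrow> ('a \<Rightarrow> real) set" where
  "IND H = conv {indicator I | I. independent_in H I}"

definition psd_on :: "'i set \<Rightarrow> ('i \<Rightarrow> 'i \<Rightarrow> real) \<Rightarrow> bool" where
  "psd_on J A \<longleftrightarrow> (\<forall>i\<in>J. \<forall>j\<in>J. A i j = A j i) \<and>
     (\<forall>c. 0 \<le> (\<Sum>i\<in>J. \<Sum>j\<in>J. c i * A i j * c j))"

text \<open>The bordered matrix \<open>R(A)\<close>; \<open>None\<close> indexes the additional row and column.\<close>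

fun bordered :: "('a \<Rightarrow> 'a \<Rightarrow> real) \<Rightarrow> 'a option \<Rightarrow> 'a option \<Rightarrow> real" where
  "bordered A None None = 1"
| "bordered A None (Some y) = A y y"
| "bordered A (Some x) None = A x x"
| "bordered A (Some x) (Some y) = A x y"

definition restr :: "('a \<Rightarrow> real) \<Rightarrow> 'a set \<Rightarrow> 'a \<Rightarrow> real" where
  "restr f U = (\<lambda>y. if y \<in> U then f y else 0)"

text \<open>\<open>TH r H\<close> is meant for an \<open>r\<close>-uniform \<open>H\<close> with \<open>r \<ge> 1\<close> and is unspecified for \<open>r = 0\<close>. The
  uniformity is an explicit argument because it cannot be recovered from \<open>H\<close> if \<open>H\<close> has no edges.
  The entries of \<open>F\<close> outside \<open>verts H \<times> verts H\<close> are irrelevant.\<close>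

fun TH :: "nat \<Rightarrow> 'a hypergraph \<Rightarrow> ('a \<Rightarrow> real) set" where
  "TH (Suc 0) H = IND H"
| "TH (Suc (Suc r)) H = {f. \<exists>F :: 'a \<Rightarrow> 'a \<Rightarrow> real.
     f = restr (\<lambda>x. F x x) (verts H) \<and>
     (\<forall>x\<in>verts H. link_verts H x \<noteq> {} \<longrightarrow>
        restr (F x) (link_verts H x) \<in> (\<lambda>g y. F x x * g y) ` TH (Suc r) (link H x)) \<and>
     psd_on (insert None (Some ` verts H)) (bordered F)}"

text \<open>\<^const>\<open>Greatest\<close> is the maximum, specified only if it is attained.\<close>

definition theta :: "nat \<Rightarrow> 'a hypergraph \<Rightarrow> real" where
  "theta r H = (GREATEST t. t \<in> (\<lambda>f. \<Sum>x\<in>verts H. f x) ` TH r H)"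


section \<open>The Hamming cube\<close>

type_synonym word = "bool list"

definition cube :: "nat \<Rightarrow> word set" where
  "cube n = {x. length x = n}"

definition hdist :: "word \<Rightarrow> word \<Rightarrow> nat" where
  "hdist x y = card {i. i < length x \<and> x ! i \<noteq> y ! i}"

definition weight :: "word \<Rightarrow> nat" where
  "weight x = card {i. i < length x \<and> x ! i}"

definition cube_level :: "nat \<Rightarrow> nat \<Rightarrow> word set" where
  "cube_level n s = {x \<in> cube n. weight x = s}"

definition zero_word :: "nat \<Rightarrow> word" where
  "zero_word n = replicate n False"

definition triangle_hypergraph :: "nat \<Rightarrow> nat \<Rightarrow> word hypergraph" where
  "triangle_hypergraph n s = (cube n,
     {{x, y, z} | x y z. x \<in> cube n \<and> y \<in> cube n \<and> z \<in> cube n \<and>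
        x \<noteq> y \<and> x \<noteq> z \<and> y \<noteq> z \<and> hdist x y = s \<and> hdist x z = s \<and> hdist y z = s})"

lemma uniform_triangle_hypergraph: "uniform 3 (triangle_hypergraph n s)"
proof -
  have "finite {x :: bool list. set x \<subseteq> UNIV \<and> length x = n}"
    by (rule finite_lists_length_eq) simp
  then have "finite (cube n)" by (simp add: cube_def)
  then show ?thesis
    by (auto simp: uniform_def triangle_hypergraph_def)
qed


section \<open>Krawtchouk polynomials\<close>

definition krawtchouk :: "nat \<Rightarrow> nat \<Rightarrow> nat \<Rightarrow> real" where
  "krawtchouk n k t =
     inverse (real (n choose k)) *
     (\<Sum>i=0..k. (-1) ^ i * real (t choose i) * real ((n - t) choose (k - i)))"

definition krawtchouk_min :: "nat \<Rightarrow> nat \<Rightarrow> real" where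
  "krawtchouk_min n s = Min {krawtchouk n k s | k. k \<in> {0..n}}"

end

theory Submission
  imports Defs
begin

text \<open>Both inequalities come from the symmetry of the cube. Write \<open>M\<close> for \<open>krawtchouk_min n s\<close>, \<open>L\<close> for
  the number of words of weight \<open>s\<close> and \<open>\<theta>\<close> for the theta number of the link of the zero word. All
  links are isomorphic by translation, and for even \<open>s \<le> 2 * n / 3\<close> the link of \<open>x\<close> lives on the whole
  sphere of radius \<open>s\<close> about \<open>x\<close>, since every point of the sphere lies in a triangle with \<open>x\<close>
  (\<open>ex_triangle\<close>).

  Upper bound. Let \<open>F\<close> be feasible with trace \<open>T\<close>. The constraint on row \<open>x\<close> bounds the sum of \<open>F x y\<close>
  over the sphere about \<open>x\<close> by \<open>F x x * \<theta>\<close>, so the entries of \<open>F\<close> at distance \<open>s\<close> add up to at most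
  \<open>T * \<theta>\<close>. From below, diagonalise the relation "at distance \<open>s\<close>" by the characters of the cube: the
  eigenvalues are \<open>L\<close> times values of Krawtchouk polynomials at \<open>s\<close>, hence at least \<open>L * M\<close>, while the
  trivial character has eigenvalue \<open>L\<close> and carries weight at least \<open>T\<^sup>2\<close> because of the border of \<open>R(F)\<close>
  (\<open>sum_over_distance_le\<close>). Comparing the two estimates gives
  \<open>T * (1 - M) \<le> 2 ^ n * (\<theta> / L - M)\<close>, where \<open>M \<le> 0\<close> by \<open>krawtchouk_min_nonpos\<close>.

  Lower bound. Let \<open>k\<close> attain the minimum \<open>M\<close>. The matrix with entries
  \<open>d\<^sup>2 + (d - d\<^sup>2) * krawtchouk n k (hdist x y)\<close> is feasible as far as semidefiniteness goes, for every
  \<open>d\<close> between \<open>0\<close> and \<open>1\<close> (\<open>theta_matrix_krawtchouk\<close>). It has diagonal \<open>d\<close>, and its entries at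
  distance \<open>s\<close> equal \<open>d * (d * (1 - M) + M)\<close>. Choosing \<open>d\<close> so that the second factor is \<open>\<theta> / L\<close>, the
  link constraint asks for the vector with constant value \<open>\<theta> / L\<close> in the theta body of the link. It lies there
  because the link is vertex-transitive: averaging an optimal solution over the automorphisms makes
  it constant (\<open>constant_in_TH_2\<close>). The optimal solution exists by compactness
  (\<open>theta_2_attained\<close>).\<close>

section \<open>Positive semidefinite bordered matrices\<close>

text \<open>The condition that \<open>R(F)\<close> is positive semidefinite, as a quadratic form in which \<open>t\<close> is the
  coordinate of the border and \<open>c\<close> collects the others.\<close>

definition theta_matrix :: "'a set \<Rightarrow> ('a \<Rightarrow> 'a \<Rightarrow> real) \<Rightarrow> bool" where
  "theta_matrix V F \<longleftrightarrow> (\<forall>x\<in>V. \<forall>y\<in>V. F x y = F y x) \<and>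
     (\<forall>t c. 0 \<le> t\<^sup>2 + 2 * t * (\<Sum>x\<in>V. c x * F x x) + (\<Sum>x\<in>V. \<Sum>y\<in>V. c x * F x y * c y))"

lemma theta_matrixD_sym: "theta_matrix V F \<Longrightarrow> x \<in> V \<Longrightarrow> y \<in> V \<Longrightarrow> F x y = F y x"
  by (auto simp: theta_matrix_def)

lemma theta_matrixD:
  "theta_matrix V F \<Longrightarrow>
    0 \<le> t\<^sup>2 + 2 * t * (\<Sum>x\<in>V. c x * F x x) + (\<Sum>x\<in>V. \<Sum>y\<in>V. c x * F x y * c y)"
  by (simp add: theta_matrix_def)

lemma psd_on_bordered_iff:
  assumes "finite V"
  shows "psd_on (insert None (Some ` V)) (bordered F) \<longleftrightarrow> theta_matrix V F"
proof -
  have form: "(\<Sum>i\<in>insert None (Some ` V). \<Sum>j\<in>insert None (Some ` V). c i * bordered F i j * c j)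
      = (c None)\<^sup>2 + 2 * c None * (\<Sum>x\<in>V. c (Some x) * F x x)
        + (\<Sum>x\<in>V. \<Sum>y\<in>V. c (Some x) * F x y * c (Some y))" for c :: "'a option \<Rightarrow> real"
    using assms by (simp add: sum.reindex sum.distrib sum_distrib_left power2_eq_square ac_simps
        flip: mult_2)
  have "(\<forall>c :: 'a option \<Rightarrow> real. Q (c None) (c \<circ> Some)) \<longleftrightarrow> (\<forall>t c. Q t c)" for Q
  proof safe
    fix t and c :: "'a \<Rightarrow> real"
    assume "\<forall>c :: 'a option \<Rightarrow> real. Q (c None) (c \<circ> Some)"
    from this[rule_format, of "case_option t c"] show "Q t c" by (simp add: comp_def)
  qed blast
  from this[of "\<lambda>t c. 0 \<le> t\<^sup>2 + 2 * t * (\<Sum>x\<in>V. c x * F x x) + (\<Sum>x\<in>V. \<Sum>y\<in>V. c x * F x y * c y)"]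
  show ?thesis
    unfolding psd_on_def theta_matrix_def form by (auto simp: comp_def)
qed

text \<open>Evaluate the form at a unit vector \<open>c\<close> with border coordinate \<open>0\<close> and \<open>-1\<close>.\<close>

lemma theta_matrix_diag_bounds:
  assumes "finite V" "theta_matrix V F" "x \<in> V"
  shows "0 \<le> F x x" "F x x \<le> 1"
proof -
  have *: "0 \<le> t\<^sup>2 + 2 * t * F x x + F x x" for t
  proof -
    have s: "(\<Sum>z\<in>V. of_bool (z = x) * g z) = g x" for g :: "'a \<Rightarrow> real"
      using assms(1,3) by (simp add: of_bool_def if_distrib if_distribR sum.delta cong: if_cong)
    show ?thesis
      using theta_matrixD[OF assms(2), of t "\<lambda>z. of_bool (z = x)"]
      by (simp add: s mult.assoc mult.commute[of _ "of_bool _"] flip: sum_distrib_left)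
  qed
  show "0 \<le> F x x" "F x x \<le> 1" using *[of 0] *[of "-1"] by simp_all
qed

text \<open>The \<open>2\<close> by \<open>2\<close> principal minors bound the off-diagonal entries by the diagonal ones; it is enough
  to test the form at the sum and the difference of two unit vectors. This makes the set of feasible
  matrices bounded.\<close>

lemma theta_matrix_entry_bound:
  assumes "finite V" "theta_matrix V F" "x \<in> V" "y \<in> V"
  shows "\<bar>F x y\<bar> \<le> 1"
proof -
  have s: "(\<Sum>z\<in>V. (of_bool (z = x) + r * of_bool (z = y)) * g z) = g x + r * g y"
    for r and g :: "'a \<Rightarrow> real"
  proof -
    have "(\<Sum>z\<in>V. (of_bool (z = x) + r * of_bool (z = y)) * g z)
      = (\<Sum>z\<in>V. if z = x then g z else 0) + (\<Sum>z\<in>V. if z = y then r * g z else 0)"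
      by (subst sum.distrib[symmetric], intro sum.cong) (auto simp: algebra_simps)
    then show ?thesis using assms(1,3,4) by simp
  qed
  have "0 \<le> F x x + r * F x y + r * (F y x + r * F y y)" for r
  proof -
    define w where "w = (\<lambda>z. of_bool (z = x) + r * of_bool (z = y))"
    have "(\<Sum>a\<in>V. \<Sum>b\<in>V. w a * F a b * w b) = (\<Sum>a\<in>V. w a * (\<Sum>b\<in>V. w b * F a b))"
      by (simp add: sum_distrib_left ac_simps)
    also have "\<dots> = F x x + r * F x y + r * (F y x + r * F y y)"
      unfolding w_def s ..
    finally show ?thesis using theta_matrixD[OF assms(2), of 0 w] by simp
  qed
  from this[of 1] this[of "-1"] show ?thesis
    using theta_matrix_diag_bounds[OF assms(1,2)] assms(3,4) theta_matrixD_sym[OF assms(2-4)]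
    by (smt (verit))
qed

text \<open>Relabelling along a bijection transports the coefficient vector \<open>c\<close> along the inverse bijection, so
  no form takes a value that the original one does not take.\<close>

lemma theta_matrix_reindex:
  assumes "bij_betw h V W" "theta_matrix W F"
  shows "theta_matrix V (\<lambda>x y. F (h x) (h y))"
  unfolding theta_matrix_def
proof (intro conjI allI ballI)
  fix x y assume "x \<in> V" "y \<in> V"
  then show "F (h x) (h y) = F (h y) (h x)"
    using theta_matrixD_sym[OF assms(2)] bij_betwE[OF assms(1)] by blast
next
  fix t :: real and c :: "'a \<Rightarrow> real"
  define k where "k = the_inv_into V h"
  have k: "k (h x) = x" if "x \<in> V" for x
    using that assms(1) by (simp add: k_def bij_betw_def the_inv_into_f_f)
  show "0 \<le> t\<^sup>2 + 2 * t * (\<Sum>x\<in>V. c x * F (h x) (h x))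
           + (\<Sum>x\<in>V. \<Sum>y\<in>V. c x * F (h x) (h y) * c y)"
    using theta_matrixD[OF assms(2), of t "c \<circ> k"]
    by (simp add: k cong: sum.cong flip: sum.reindex_bij_betw[OF assms(1)])
qed

lemma theta_matrix_average:
  fixes F :: "'p \<Rightarrow> 'a \<Rightarrow> 'a \<Rightarrow> real"
  assumes "finite P" "P \<noteq> {}" "\<And>p. p \<in> P \<Longrightarrow> theta_matrix V (F p)"
  shows "theta_matrix V (\<lambda>x y. (\<Sum>p\<in>P. F p x y) / card P)"
  unfolding theta_matrix_def
proof (intro conjI allI ballI)
  fix x y assume "x \<in> V" "y \<in> V"
  then show "(\<Sum>p\<in>P. F p x y) / card P = (\<Sum>p\<in>P. F p y x) / card P"
    using theta_matrixD_sym[OF assms(3)] by (metis (mono_tags, lifting) sum.cong)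
next
  fix t :: real and c :: "'a \<Rightarrow> real"
  have card: "card P > 0" using assms by (simp add: card_gt_0_iff)
  have swap1: "(\<Sum>x\<in>V. c x * ((\<Sum>p\<in>P. F p x x) / card P)) = (\<Sum>p\<in>P. \<Sum>x\<in>V. c x * F p x x) / card P"
    by (subst sum.swap) (simp add: sum_divide_distrib sum_distrib_left)
  have "(\<Sum>p\<in>P. \<Sum>x\<in>V. \<Sum>y\<in>V. c x * F p x y * c y) = (\<Sum>x\<in>V. \<Sum>y\<in>V. \<Sum>p\<in>P. c x * F p x y * c y)"
    by (subst sum.swap) (intro sum.cong refl sum.swap)
  then have swap2: "(\<Sum>x\<in>V. \<Sum>y\<in>V. c x * ((\<Sum>p\<in>P. F p x y) / card P) * c y)
      = (\<Sum>p\<in>P. \<Sum>x\<in>V. \<Sum>y\<in>V. c x * F p x y * c y) / card P"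
    by (simp add: sum_divide_distrib sum_distrib_left sum_distrib_right)
  have "0 \<le> (\<Sum>p\<in>P. t\<^sup>2 + 2 * t * (\<Sum>x\<in>V. c x * F p x x) + (\<Sum>x\<in>V. \<Sum>y\<in>V. c x * F p x y * c y))"
    by (intro sum_nonneg theta_matrixD assms)
  also have "\<dots> = card P * (t\<^sup>2 + 2 * t * (\<Sum>x\<in>V. c x * ((\<Sum>p\<in>P. F p x x) / card P))
     + (\<Sum>x\<in>V. \<Sum>y\<in>V. c x * ((\<Sum>p\<in>P. F p x y) / card P) * c y))"
    unfolding swap1 swap2 using card by (simp add: sum.distrib sum_distrib_left[symmetric] field_simps)
  finally show "0 \<le> t\<^sup>2 + 2 * t * (\<Sum>x\<in>V. c x * ((\<Sum>p\<in>P. F p x x) / card P))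
     + (\<Sum>x\<in>V. \<Sum>y\<in>V. c x * ((\<Sum>p\<in>P. F p x y) / card P) * c y)"
    using card by (simp add: zero_le_mult_iff)
qed


section \<open>The theta number of a graph\<close>

text \<open>The link of a vertex \<open>x\<close> of a graph has all singletons of neighbours of \<open>x\<close> as edges, so the
  constraint on row \<open>x\<close> says that \<open>F\<close> vanishes on the edges at \<open>x\<close>. This recovers the Lovasz theta
  body; compare \<open>TH_2_iff\<close>.\<close>

definition edge_free :: "'a hypergraph \<Rightarrow> ('a \<Rightarrow> 'a \<Rightarrow> real) \<Rightarrow> bool" where
  "edge_free G F \<longleftrightarrow> (\<forall>x\<in>verts G. \<forall>y\<in>verts G. {x, y} \<in> edges G \<longrightarrow> F x y = 0)"

text \<open>Every neighbour \<open>y\<close> of \<open>x\<close> yields the edge \<open>{y}\<close> of the link, so only the empty set is independent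
  there.\<close>

lemma uniform_2_link:
  assumes "uniform 2 G"
  shows "link_verts G x = {y. {x, y} \<in> edges G}"
    and "IND (link G x) = {\<lambda>_. 0}"
proof -
  have edge: "e \<subseteq> verts G" "card e = 2" if "e \<in> edges G" for e
    using assms that by (auto simp: uniform_def)
  show lv: "link_verts G x = {y. {x, y} \<in> edges G}"
  proof (intro set_eqI iffI)
    fix y assume "y \<in> link_verts G x"
    then obtain e where e: "e \<in> edges G" "x \<in> e" "y \<in> e" "y \<noteq> x"
      by (auto simp: link_verts_def)
    moreover from this edge(2)[of e] have "e = {x, y}" by (auto simp: card_2_iff)
    ultimately show "y \<in> {y. {x, y} \<in> edges G}" by simp
  next
    fix y assume "y \<in> {y. {x, y} \<in> edges G}"
    then show "y \<in> link_verts G x"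
      using edge[of "{x, y}"] by (auto simp: link_verts_def)
  qed
  have "independent_in (link G x) I \<longleftrightarrow> I = {}" for I
  proof
    assume I: "independent_in (link G x) I"
    show "I = {}"
    proof (rule ccontr)
      assume "I \<noteq> {}"
      then obtain y where "y \<in> I" by blast
      then have "{y} \<subseteq> I" "{y} \<in> edges (link G x)"
        using I lv by (auto simp: independent_in_def link_def)
      with I show False by (auto simp: independent_in_def)
    qed
  next
    assume "I = {}"
    moreover have "{x} \<notin> edges G" using edge(2)[of "{x}"] by auto
    ultimately show "independent_in (link G x) I"
      by (auto simp: independent_in_def link_def)
  qed
  moreover have "conv {\<lambda>_::'a. 0} = {\<lambda>_. 0}"
  proof (intro set_eqI iffI)
    fix f :: "'a \<Rightarrow> real" assume "f \<in> conv {\<lambda>_. 0}"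
    then show "f \<in> {\<lambda>_. 0}"
      by (auto simp: conv_def fun_eq_iff subset_singleton_iff)
  next
    fix f :: "'a \<Rightarrow> real" assume "f \<in> {\<lambda>_. 0}"
    then show "f \<in> conv {\<lambda>_. 0}"
      unfolding conv_def by (auto intro!: exI[of _ "{\<lambda>_::'a. 0::real}"] exI[of _ "\<lambda>_. 1"])
  qed
  moreover have "(indicator {} :: 'a \<Rightarrow> real) = (\<lambda>_. 0)" by auto
  ultimately show "IND (link G x) = {\<lambda>_. 0}"
    by (simp add: IND_def)
qed

lemma TH_2_iff:
  assumes "uniform 2 G"
  shows "f \<in> TH 2 G \<longleftrightarrow>
    (\<exists>F. f = restr (\<lambda>x. F x x) (verts G) \<and> edge_free G F \<and> theta_matrix (verts G) F)"
proof -
  have fin: "finite (verts G)" using assms by (simp add: uniform_def)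
  have sub: "{x, y} \<in> edges G \<Longrightarrow> y \<in> verts G" for x y
    using assms by (auto simp: uniform_def)
  have "(\<forall>x\<in>verts G. link_verts G x \<noteq> {} \<longrightarrow> restr (F x) (link_verts G x)
        \<in> (\<lambda>g y. F x x * g y) ` TH (Suc 0) (link G x)) \<longleftrightarrow> edge_free G F" for F
    using sub by (simp add: uniform_2_link[OF assms] edge_free_def restr_def fun_eq_iff) blast
  then show ?thesis
    using psd_on_bordered_iff[OF fin] by (simp add: numeral_2_eq_2)
qed

lemma theta_eqI:
  assumes "f \<in> TH r H" "\<And>g. g \<in> TH r H \<Longrightarrow> (\<Sum>x\<in>verts H. g x) \<le> (\<Sum>x\<in>verts H. f x)"
  shows "theta r H = (\<Sum>x\<in>verts H. f x)"
  unfolding theta_def using assms by (intro Greatest_equality) auto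

text \<open>Being feasible is a conjunction of equations and weak inequalities between continuous functions of
  the entries, and the entries are bounded, so the feasible matrices that vanish outside \<open>V\<close> form a
  compact set, on which the trace attains its maximum. Setting the entries outside \<open>V\<close> to zero loses
  nothing.\<close>

lemma theta_2_attained:
  assumes "uniform 2 G"
  obtains F where "edge_free G F" "theta_matrix (verts G) F" "(\<Sum>x\<in>verts G. F x x) = theta 2 G"
    "\<And>F'. edge_free G F' \<Longrightarrow> theta_matrix (verts G) F' \<Longrightarrow> (\<Sum>x\<in>verts G. F' x x) \<le> theta 2 G"
proof -
  define V where "V = verts G"
  have fin: "finite V" using assms by (simp add: uniform_def V_def)
  \<comment> \<open>The matrices that vanish outside \<open>V\<close> and have entries in \<open>{-1..1}\<close> form a compact box (Tychonoff).\<close>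
  define B where "B = (\<lambda>x y. if x \<in> V \<and> y \<in> V then {-1..1::real} else {0})"
  define box where "box = (PiE UNIV (\<lambda>x. PiE UNIV (B x)))"
  define S where "S = box \<inter> {F. edge_free G F \<and> theta_matrix V F}"
  have "compactin (product_topology (\<lambda>_. euclidean) UNIV) (PiE UNIV (B x))" for x
    by (subst compactin_PiE) (auto simp: B_def)
  then have "compactin (product_topology (\<lambda>_. euclidean) UNIV) box"
    unfolding box_def by (subst compactin_PiE) (auto simp: euclidean_product_topology)
  then have box: "compact box" by (simp add: euclidean_product_topology)
  have cont: "continuous_on UNIV (\<lambda>F :: 'a \<Rightarrow> 'a \<Rightarrow> real. F x y)" for x y
    by (rule continuous_on_product_then_coordinatewise[of UNIV "\<lambda>F. F x"]) simp
  have "closed {F :: 'a \<Rightarrow> 'a \<Rightarrow> real. edge_free G F \<and> theta_matrix V F}"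
    unfolding edge_free_def theta_matrix_def Ball_def imp_conjR all_conj_distrib
    by (intro closed_Collect_conj closed_Collect_all closed_Collect_imp open_Collect_const
        closed_Collect_eq closed_Collect_le continuous_intros cont)
  then have "compact S" unfolding S_def using box by (rule compact_Int_closed[rotated])
  moreover have "(\<lambda>_ _. 0) \<in> S"
    by (auto simp: S_def box_def B_def edge_free_def theta_matrix_def)
  moreover have "continuous_on S (\<lambda>F. \<Sum>x\<in>V. F x x)"
    by (intro continuous_on_sum continuous_on_subset[OF cont]) auto
  ultimately obtain F where F: "F \<in> S" "\<And>F'. F' \<in> S \<Longrightarrow> (\<Sum>x\<in>V. F' x x) \<le> (\<Sum>x\<in>V. F x x)"
    using continuous_attains_sup[of S "\<lambda>F. \<Sum>x\<in>V. F x x"] by blast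
  have max: "(\<Sum>x\<in>V. F' x x) \<le> (\<Sum>x\<in>V. F x x)" if "edge_free G F'" "theta_matrix V F'" for F'
  proof -
    define F'' where "F'' = (\<lambda>x y. if x \<in> V \<and> y \<in> V then F' x y else 0)"
    have "theta_matrix V F''" "edge_free G F''"
      using that by (simp_all add: theta_matrix_def edge_free_def F''_def V_def cong: sum.cong)
    moreover have "F'' \<in> box"
      using theta_matrix_entry_bound[OF fin that(2)] by (auto simp: box_def B_def F''_def abs_le_iff)
    ultimately have "F'' \<in> S" by (simp add: S_def)
    from F(2)[OF this] show ?thesis by (simp add: F''_def)
  qed
  have sum: "(\<Sum>x\<in>verts G. restr (\<lambda>x. F x x) (verts G) x) = (\<Sum>x\<in>V. F x x)" for F :: "'a \<Rightarrow> 'a \<Rightarrow> real"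
    by (simp add: restr_def V_def)
  have "theta 2 G = (\<Sum>x\<in>verts G. restr (\<lambda>x. F x x) (verts G) x)"
  proof (rule theta_eqI)
    show "restr (\<lambda>x. F x x) (verts G) \<in> TH 2 G"
      using F(1) TH_2_iff[OF assms] by (auto simp: S_def V_def)
  next
    fix g assume "g \<in> TH 2 G"
    then obtain F' where F': "g = restr (\<lambda>x. F' x x) (verts G)" "edge_free G F'" "theta_matrix V F'"
      unfolding TH_2_iff[OF assms] V_def by blast
    show "sum g (verts G) \<le> sum (restr (\<lambda>x. F x x) (verts G)) (verts G)"
      unfolding F'(1) sum by (rule max[OF F'(2,3)])
  qed
  then have "theta 2 G = (\<Sum>x\<in>V. F x x)" by (simp add: sum)
  with F(1) max show thesis by (intro that[of F]) (auto simp: S_def V_def)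
qed

lemma sum_diag_le_theta_2:
  assumes "uniform 2 G" "edge_free G F" "theta_matrix (verts G) F"
  shows "(\<Sum>x\<in>verts G. F x x) \<le> theta 2 G"
  by (rule theta_2_attained[OF assms(1)]) (use assms(2,3) in blast)

lemma sum_le_theta_2:
  assumes "uniform 2 G" "f \<in> TH 2 G"
  shows "(\<Sum>x\<in>verts G. f x) \<le> theta 2 G"
proof -
  obtain F where F: "f = restr (\<lambda>x. F x x) (verts G)" "edge_free G F" "theta_matrix (verts G) F"
    using assms(2) unfolding TH_2_iff[OF assms(1)] by blast
  show ?thesis using sum_diag_le_theta_2[OF assms(1) F(2,3)] by (simp add: F(1) restr_def)
qed

lemma theta_2_nonneg:
  assumes "uniform 2 G"
  shows "0 \<le> theta 2 G"
proof -
  have "restr (\<lambda>_. 0) (verts G) \<in> TH 2 G"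
    unfolding TH_2_iff[OF assms] by (rule exI[of _ "\<lambda>_ _. 0"]) (auto simp: edge_free_def theta_matrix_def)
  from sum_le_theta_2[OF assms this] show ?thesis by (simp add: restr_def)
qed

lemma theta_2_le_card:
  assumes "uniform 2 G"
  shows "theta 2 G \<le> card (verts G)"
proof -
  have fin: "finite (verts G)" using assms by (simp add: uniform_def)
  obtain F where "theta_matrix (verts G) F" "(\<Sum>x\<in>verts G. F x x) = theta 2 G"
    using theta_2_attained[OF assms] by metis
  then show ?thesis
    using theta_matrix_diag_bounds(2)[OF fin] sum_bounded_above[of "verts G" "\<lambda>x. F x x" 1] by force
qed


section \<open>Isomorphisms and vertex-transitive graphs\<close>

definition graph_iso :: "('a \<Rightarrow> 'b) \<Rightarrow> 'a hypergraph \<Rightarrow> 'b hypergraph \<Rightarrow> bool" where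
  "graph_iso h G G' \<longleftrightarrow> bij_betw h (verts G) (verts G') \<and>
     (\<forall>x\<in>verts G. \<forall>y\<in>verts G. {x, y} \<in> edges G \<longleftrightarrow> {h x, h y} \<in> edges G')"

lemma edge_free_reindex:
  assumes "graph_iso h G G'" "edge_free G' F"
  shows "edge_free G (\<lambda>x y. F (h x) (h y))"
  using assms by (auto simp: graph_iso_def edge_free_def bij_betw_def)

lemma TH_2_reindex:
  assumes "uniform 2 G" "uniform 2 G'" "graph_iso h G G'" "f \<in> TH 2 G'"
  shows "restr (f \<circ> h) (verts G) \<in> TH 2 G"
proof -
  have bij: "bij_betw h (verts G) (verts G')" using assms(3) by (simp add: graph_iso_def)
  obtain F where F: "f = restr (\<lambda>x. F x x) (verts G')" "edge_free G' F" "theta_matrix (verts G') F"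
    using assms(4) TH_2_iff[OF assms(2)] by blast
  then have "restr (f \<circ> h) (verts G) = restr (\<lambda>x. F (h x) (h x)) (verts G)"
    using bij_betwE[OF bij] by (auto simp: restr_def)
  then show ?thesis
    unfolding TH_2_iff[OF assms(1)]
    using edge_free_reindex[OF assms(3) F(2)] theta_matrix_reindex[OF bij F(3)]
    by (intro exI[of _ "\<lambda>x y. F (h x) (h y)"]) simp
qed

lemma theta_2_le_iso:
  assumes "uniform 2 G" "uniform 2 G'" "graph_iso h G G'"
  shows "theta 2 G' \<le> theta 2 G"
proof -
  have bij: "bij_betw h (verts G) (verts G')" using assms(3) by (simp add: graph_iso_def)
  obtain F where F: "edge_free G' F" "theta_matrix (verts G') F" "(\<Sum>x\<in>verts G'. F x x) = theta 2 G'"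
    using theta_2_attained[OF assms(2)] by metis
  have "theta 2 G' = (\<Sum>x\<in>verts G. F (h x) (h x))"
    using F(3) sum.reindex_bij_betw[OF bij, of "\<lambda>x. F x x"] by simp
  also have "\<dots> \<le> theta 2 G"
    by (rule sum_diag_le_theta_2[OF assms(1) edge_free_reindex[OF assms(3) F(1)] theta_matrix_reindex[OF bij F(2)]])
  finally show ?thesis .
qed

lemma graph_iso_inv:
  assumes "graph_iso h G G'"
  shows "graph_iso (the_inv_into (verts G) h) G' G"
proof -
  let ?k = "the_inv_into (verts G) h"
  have h: "bij_betw h (verts G) (verts G')"
    and edge: "\<And>x y. x \<in> verts G \<Longrightarrow> y \<in> verts G \<Longrightarrow> {x, y} \<in> edges G \<longleftrightarrow> {h x, h y} \<in> edges G'"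
    using assms by (auto simp: graph_iso_def)
  have k: "bij_betw ?k (verts G') (verts G)" using h by (rule bij_betw_the_inv_into)
  show ?thesis
    unfolding graph_iso_def
  proof (intro conjI ballI k)
    fix x y assume "x \<in> verts G'" "y \<in> verts G'"
    then have "?k x \<in> verts G" "?k y \<in> verts G" "h (?k x) = x" "h (?k y) = y"
      using bij_betw_apply[OF k] f_the_inv_into_f_bij_betw[OF h] by blast+
    with edge[of "?k x" "?k y"] show "({x, y} \<in> edges G') = ({?k x, ?k y} \<in> edges G)"
      by metis
  qed
qed

lemma graph_iso_bij: "graph_iso h G G' \<Longrightarrow> bij_betw h (verts G) (verts G')"
  by (simp add: graph_iso_def)

lemma graph_iso_edge:
  assumes "graph_iso h G G'" "x \<in> verts G" "y \<in> verts G"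
  shows "{x, y} \<in> edges G \<longleftrightarrow> {h x, h y} \<in> edges G'"
  using assms unfolding graph_iso_def by (elim conjE) (drule bspec, assumption, erule bspec)

lemma graph_iso_comp:
  assumes g: "graph_iso g G G'" and h: "graph_iso h G' G''"
  shows "graph_iso (h \<circ> g) G G''"
  unfolding graph_iso_def
proof (intro conjI ballI)
  show "bij_betw (h \<circ> g) (verts G) (verts G'')"
    by (rule bij_betw_trans[OF graph_iso_bij[OF g] graph_iso_bij[OF h]])
  fix x y assume xy: "x \<in> verts G" "y \<in> verts G"
  note V' = bij_betw_apply[OF graph_iso_bij[OF g]]
  show "({x, y} \<in> edges G) = ({(h \<circ> g) x, (h \<circ> g) y} \<in> edges G'')"
    unfolding comp_def
    by (rule trans[OF graph_iso_edge[OF g xy] graph_iso_edge[OF h V'[OF xy(1)] V'[OF xy(2)]]])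
qed

lemma graph_iso_cong:
  assumes eq: "\<And>x. x \<in> verts G \<Longrightarrow> g x = h x" and g: "graph_iso g G G'"
  shows "graph_iso h G G'"
  unfolding graph_iso_def
proof (intro conjI ballI)
  show "bij_betw h (verts G) (verts G')"
    by (rule iffD1[OF bij_betw_cong[OF eq] graph_iso_bij[OF g]])
  fix x y assume xy: "x \<in> verts G" "y \<in> verts G"
  show "({x, y} \<in> edges G) = ({h x, h y} \<in> edges G')"
    using graph_iso_edge[OF g xy] unfolding eq[OF xy(1)] eq[OF xy(2)] .
qed

lemma theta_2_iso:
  assumes "uniform 2 G" "uniform 2 G'" "graph_iso h G G'"
  shows "theta 2 G = theta 2 G'"
  by (rule antisym[OF theta_2_le_iso[OF assms(2,1) graph_iso_inv[OF assms(3)]] theta_2_le_iso[OF assms]])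

text \<open>Averaging an optimal matrix over all automorphisms keeps it feasible and keeps its trace. The diagonal
  of the average is constant on orbits, hence constant by transitivity.\<close>

lemma constant_in_TH_2:
  assumes G: "uniform 2 G"
    and trans: "\<And>x y. x \<in> verts G \<Longrightarrow> y \<in> verts G \<Longrightarrow> \<exists>g. graph_iso g G G \<and> g x = y"
  shows "restr (\<lambda>_. theta 2 G / card (verts G)) (verts G) \<in> TH 2 G"
proof -
  define V where "V = verts G"
  have fin: "finite V" using G by (simp add: uniform_def V_def)
  define P where "P = {p. p permutes V \<and> graph_iso p G G}"
  have P: "finite P" "id \<in> P"
  proof -
    show "finite P" unfolding P_def by (rule finite_subset[OF _ finite_permutations[OF fin]]) blast
    show "id \<in> P" by (simp add: P_def graph_iso_def permutes_id)
  qed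
  have comp: "p \<circ> q \<in> P" if "p \<in> P" "q \<in> P" for p q
    using that by (simp add: P_def permutes_compose graph_iso_comp[of q G G p G])
  have inv: "inv p \<in> P" if "p \<in> P" for p
  proof -
    have p: "p permutes V" "graph_iso p G G" using that by (auto simp: P_def)
    have "graph_iso (inv p) G G"
    proof (rule graph_iso_cong[OF _ graph_iso_inv[OF p(2)]])
      fix x assume "x \<in> verts G"
      then have "inv p x \<in> verts G" using permutes_in_image[OF permutes_inv[OF p(1)]] by (simp add: V_def)
      then show "the_inv_into (verts G) p x = inv p x"
        using permutes_inj_on[OF p(1)] permutes_inverses(1)[OF p(1)] by (intro the_inv_into_f_eq)
    qed
    then show ?thesis using permutes_inv[OF p(1)] by (simp add: P_def)
  qed
  have trans': "\<exists>p\<in>P. p x = y" if "x \<in> V" "y \<in> V" for x y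
  proof -
    obtain g where g: "graph_iso g G G" "g x = y" using trans \<open>x \<in> V\<close> \<open>y \<in> V\<close> by (auto simp: V_def)
    \<comment> \<open>Composition with inverses needs total bijections, so \<open>g\<close> is replaced by the identity off \<open>V\<close>.\<close>
    define p where "p = (\<lambda>z. if z \<in> V then g z else z)"
    have iso: "graph_iso p G G" by (rule graph_iso_cong[OF _ g(1)]) (simp add: p_def V_def)
    then have "bij_betw p V V" using graph_iso_bij[OF iso] by (simp add: V_def)
    then have "p permutes V" by (intro bij_imp_permutes) (auto simp: p_def)
    then show ?thesis using iso g(2) \<open>x \<in> V\<close> by (intro bexI[of _ p]) (simp_all add: P_def p_def)
  qed
  obtain F where F: "edge_free G F" "theta_matrix V F" "(\<Sum>x\<in>V. F x x) = theta 2 G"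
    using theta_2_attained[OF G] unfolding V_def by metis
  define A where "A = (\<lambda>x y. (\<Sum>p\<in>P. F (p x) (p y)) / card P)"
  have "theta_matrix V A"
    unfolding A_def
  proof (rule theta_matrix_average)
    fix p assume "p \<in> P"
    then show "theta_matrix V (\<lambda>x y. F (p x) (p y))"
      using theta_matrix_reindex[OF permutes_imp_bij F(2)] by (simp add: P_def)
  qed (use P in auto)
  moreover have "edge_free G A"
  proof -
    have "edge_free G (\<lambda>x y. F (p x) (p y))" if "p \<in> P" for p
      using edge_free_reindex[OF _ F(1), of p G] that by (simp add: P_def)
    then show ?thesis by (simp add: edge_free_def A_def)
  qed
  moreover have "A x x = theta 2 G / card V" if "x \<in> V" for x
  proof -
    have const: "A y y = A x x" if y: "y \<in> V" for y
    proof -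
      obtain q where q: "q \<in> P" "q x = y" using trans' \<open>x \<in> V\<close> y by blast
      have q': "q permutes V" using q by (simp add: P_def)
      have "(\<Sum>p\<in>P. F (p y) (p y)) = (\<Sum>p\<in>P. F (p x) (p x))"
        by (rule sum.reindex_bij_witness[of _ "\<lambda>p. p \<circ> inv q" "\<lambda>p. p \<circ> q"])
          (use q(1) comp inv in \<open>simp_all add: comp_assoc permutes_inv_o[OF q'] permutes_inverses[OF q'] flip: q(2)\<close>)
      then show ?thesis by (simp add: A_def)
    qed
    have "card V * A x x = (\<Sum>y\<in>V. A y y)" using const by simp
    also have "\<dots> = (\<Sum>p\<in>P. \<Sum>y\<in>V. F (p y) (p y)) / card P"
      by (simp add: A_def sum_divide_distrib sum.swap[of _ V P])
    also have "(\<Sum>p\<in>P. \<Sum>y\<in>V. F (p y) (p y)) = (\<Sum>p\<in>P. theta 2 G)"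
    proof (intro sum.cong refl)
      fix p assume "p \<in> P"
      then show "(\<Sum>y\<in>V. F (p y) (p y)) = theta 2 G"
        using sum.reindex_bij_betw[of p V V "\<lambda>y. F y y"] F(3) by (simp add: P_def permutes_imp_bij)
    qed
    also have "\<dots> / card P = theta 2 G" using P by (auto simp: card_gt_0_iff)
    finally have "card V * A x x = theta 2 G" .
    moreover have "card V > 0" using fin that by (auto simp: card_gt_0_iff)
    ultimately show ?thesis by (simp add: field_simps)
  qed
  then have "restr (\<lambda>x. A x x) V = restr (\<lambda>_. theta 2 G / card V) V" by (auto simp: restr_def)
  ultimately show ?thesis
    unfolding TH_2_iff[OF G] V_def[symmetric] by (intro exI[of _ A]) auto
qed


section \<open>Characters of the cube and Krawtchouk polynomials\<close>

definition supp :: "word \<Rightarrow> nat set" where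
  "supp x = {i. i < length x \<and> x ! i}"

text \<open>The character of the group \<open>\<int>\<^sub>2\<^sup>n\<close> that belongs to \<open>U\<close>, with a word given by its support \<open>X\<close>. The
  two arguments play symmetric roles.\<close>

definition chi :: "nat set \<Rightarrow> nat set \<Rightarrow> real" where
  "chi U X = (-1) ^ card (U \<inter> X)"

lemma chi_commute: "chi U X = chi X U"
  by (simp add: chi_def Int_commute)

lemma chi_empty [simp]: "chi {} X = 1" "chi U {} = 1"
  by (simp_all add: chi_def)

lemma finite_supp [simp]: "finite (supp x)"
  by (simp add: supp_def)

lemma bij_betw_supp: "bij_betw supp (cube n) (Pow {..<n})"
proof (rule bij_betw_byWitness[where f' = "\<lambda>A. map (\<lambda>i. i \<in> A) [0..<n]"])
  show "\<forall>x\<in>cube n. map (\<lambda>i. i \<in> supp x) [0..<n] = x"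
    by (auto simp: cube_def supp_def intro!: nth_equalityI)
qed (auto simp: cube_def supp_def)

lemma finite_cube [simp]: "finite (cube n)"
  using bij_betw_finite[OF bij_betw_supp, of n] by simp

lemma supp_subset: "x \<in> cube n \<Longrightarrow> supp x \<subseteq> {..<n}"
  by (auto simp: cube_def supp_def)

lemma supp_inj: "x \<in> cube n \<Longrightarrow> y \<in> cube n \<Longrightarrow> supp x = supp y \<longleftrightarrow> x = y"
  using bij_betw_supp[of n] by (auto simp: bij_betw_def dest: inj_onD)

lemma ex_word_supp:
  assumes "A \<subseteq> {..<n}"
  obtains x where "x \<in> cube n" "supp x = A"
proof -
  have "A \<in> supp ` cube n" using bij_betw_supp[of n] assms by (simp add: bij_betw_def)
  then show thesis using that by blast
qed

lemma card_cube: "card (cube n) = 2 ^ n"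
  using bij_betw_same_card[OF bij_betw_supp, of n] by (simp add: card_Pow)

lemma weight_eq: "weight x = card (supp x)"
  by (simp add: weight_def supp_def)

lemma hdist_eq:
  assumes "x \<in> cube n" "y \<in> cube n"
  shows "hdist x y = card (sym_diff (supp x) (supp y))"
  using assms by (auto simp: hdist_def supp_def cube_def intro!: arg_cong[where f = card])

lemma hdist_commute: "x \<in> cube n \<Longrightarrow> y \<in> cube n \<Longrightarrow> hdist x y = hdist y x"
  by (simp add: hdist_eq Un_commute)

lemma hdist_0_iff: "x \<in> cube n \<Longrightarrow> y \<in> cube n \<Longrightarrow> hdist x y = 0 \<longleftrightarrow> x = y"
  by (auto simp: hdist_eq card_eq_0_iff simp flip: supp_inj)

lemma card_cube_level: "card (cube_level n s) = n choose s"
proof -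
  have "bij_betw supp (cube_level n s) {A. A \<subseteq> {..<n} \<and> card A = s}"
    unfolding bij_betw_def
  proof
    show "inj_on supp (cube_level n s)"
      using bij_betw_supp[of n] by (auto simp: bij_betw_def cube_level_def intro: inj_on_subset)
    show "supp ` cube_level n s = {A. A \<subseteq> {..<n} \<and> card A = s}"
    proof (intro set_eqI iffI)
      fix A assume "A \<in> {A. A \<subseteq> {..<n} \<and> card A = s}"
      then show "A \<in> supp ` cube_level n s"
        by (auto simp: cube_level_def weight_eq elim: ex_word_supp)
    qed (use supp_subset in \<open>auto simp: cube_level_def weight_eq\<close>)
  qed
  then show ?thesis by (simp add: bij_betw_same_card n_subsets)
qed

lemma chi_mult:
  assumes "finite X" "finite Y"
  shows "chi U X * chi U Y = chi U (sym_diff X Y)"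
proof -
  let ?c = "card (U \<inter> X \<inter> Y)"
  have X: "card (U \<inter> X) = card (U \<inter> (X - Y)) + ?c"
    using card_Int_Diff[of "U \<inter> X" Y] assms by (simp add: Int_Diff)
  have Y: "card (U \<inter> Y) = card (U \<inter> (Y - X)) + ?c"
    using card_Int_Diff[of "U \<inter> Y" X] assms by (simp add: Int_Diff Int_ac)
  have "card (U \<inter> sym_diff X Y) = card (U \<inter> (X - Y)) + card (U \<inter> (Y - X))"
    using assms unfolding Int_Un_distrib by (intro card_Un_disjoint) auto
  with X Y have "card (U \<inter> X) + card (U \<inter> Y) = card (U \<inter> sym_diff X Y) + 2 * ?c" by simp
  then have "(-1 :: real) ^ (card (U \<inter> X) + card (U \<inter> Y)) = (-1) ^ card (U \<inter> sym_diff X Y)"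
    by (simp add: power_add power_mult)
  then show ?thesis by (simp add: chi_def power_add)
qed

text \<open>Orthogonality of characters: the sum factors as the product over \<open>i \<in> N\<close> of \<open>1 + (-1)\<close> or \<open>1 + 1\<close>,
  according to whether \<open>i \<in> D\<close>.\<close>

lemma sum_chi_Pow:
  assumes "finite N" "D \<subseteq> N"
  shows "(\<Sum>U\<in>Pow N. chi U D) = (if D = {} then 2 ^ card N else 0)"
proof -
  have chi_prod: "chi U D = (\<Prod>i\<in>U. if i \<in> D then -1 else 1)" if "U \<in> Pow N" for U
  proof -
    have "finite U" using that assms finite_subset by auto
    then show ?thesis by (simp add: chi_def prod.If_cases Int_def)
  qed
  have "(\<Sum>U\<in>Pow N. chi U D) = (\<Prod>i\<in>N. (if i \<in> D then -1 else 1) + 1)"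
    using assms by (subst prod_add) (auto simp: chi_prod intro!: sum.cong)
  also have "\<dots> = (if D = {} then 2 ^ card N else 0)"
  proof (cases "D = {}")
    case False
    then show ?thesis using assms by (auto intro!: prod_zero)
  qed simp
  finally show ?thesis .
qed

lemma card_subsets_meeting:
  assumes "finite N" "X \<subseteq> N" "i \<le> k"
  shows "card {U. U \<subseteq> N \<and> card U = k \<and> card (U \<inter> X) = i}
    = (card X choose i) * ((card N - card X) choose (k - i))"
proof -
  have fin: "finite X" using assms finite_subset by blast
  have cardU: "card U = card (U \<inter> X) + card (U - X)" if "U \<subseteq> N" for U
    using that assms(1) by (intro card_Int_Diff finite_subset[of U N])
  have *: "card (A \<union> B) = card A + card B" "(A \<union> B) \<inter> X = A" "(A \<union> B) - X = B"
    if "A \<subseteq> X" "B \<subseteq> N - X" for A B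
    using that assms(1) fin finite_subset[of A X] finite_subset[of B N]
    by (auto intro!: card_Un_disjoint)
  have "bij_betw (\<lambda>U. (U \<inter> X, U - X)) {U. U \<subseteq> N \<and> card U = k \<and> card (U \<inter> X) = i}
      ({A. A \<subseteq> X \<and> card A = i} \<times> {B. B \<subseteq> N - X \<and> card B = k - i})"
    by (rule bij_betw_byWitness[where f' = "\<lambda>(A, B). A \<union> B"])
      (use assms(2,3) cardU * in auto)
  then have "card {U. U \<subseteq> N \<and> card U = k \<and> card (U \<inter> X) = i}
      = card ({A. A \<subseteq> X \<and> card A = i} \<times> {B. B \<subseteq> N - X \<and> card B = k - i})"
    by (rule bij_betw_same_card)
  then show ?thesis
    using assms fin by (simp add: card_cartesian_product n_subsets card_Diff_subset)
qed

text \<open>Krawtchouk polynomials are the averages of the characters of a fixed weight: grouping the sets \<open>U\<close> by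
  the size \<open>i\<close> of \<open>U \<inter> X\<close> gives the defining sum.\<close>

lemma sum_chi_level:
  assumes "X \<subseteq> {..<n}" "k \<le> n"
  shows "(\<Sum>U | U \<subseteq> {..<n} \<and> card U = k. chi U X) = real (n choose k) * krawtchouk n k (card X)"
proof -
  let ?S = "{U. U \<subseteq> {..<n} \<and> card U = k}"
  have fin: "finite ?S" by simp
  have sub: "(\<lambda>U. card (U \<inter> X)) ` ?S \<subseteq> {0..k}"
    by (auto intro!: card_mono intro: finite_subset[of _ "{..<n}"])
  have "(\<Sum>U\<in>?S. chi U X) = (\<Sum>i=0..k. \<Sum>U | U \<in> ?S \<and> card (U \<inter> X) = i. chi U X)"
    using sum.group[OF fin _ sub, of "\<lambda>U. chi U X"] by simp
  also have "\<dots> = (\<Sum>i=0..k. (-1) ^ i * real (card {U. U \<subseteq> {..<n} \<and> card U = k \<and> card (U \<inter> X) = i}))"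
    by (intro sum.cong refl) (simp add: chi_def conj_assoc)
  also have "\<dots> = (\<Sum>i=0..k. (-1) ^ i * real (card X choose i) * real ((n - card X) choose (k - i)))"
    using assms(1) by (intro sum.cong refl) (simp add: card_subsets_meeting)
  also have "\<dots> = real (n choose k) * krawtchouk n k (card X)"
    using assms(2) by (simp add: krawtchouk_def)
  finally show ?thesis .
qed

text \<open>Sum \<open>chi U W\<close> over all \<open>U\<close> of size \<open>k\<close> and \<open>W\<close> of size \<open>s\<close> in both orders.\<close>

lemma krawtchouk_commute:
  assumes "k \<le> n" "s \<le> n"
  shows "krawtchouk n k s = krawtchouk n s k"
proof -
  let ?L = "\<lambda>k. {U. U \<subseteq> {..<n} \<and> card U = k}"
  have "real (n choose s) * (real (n choose k) * krawtchouk n k s) = (\<Sum>W\<in>?L s. \<Sum>U\<in>?L k. chi U W)"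
    using sum_chi_level[of _ n k] assms by (simp add: n_subsets)
  also have "\<dots> = (\<Sum>U\<in>?L k. \<Sum>W\<in>?L s. chi W U)"
    by (subst sum.swap) (simp add: chi_commute)
  also have "\<dots> = real (n choose k) * (real (n choose s) * krawtchouk n s k)"
    using sum_chi_level[of _ n s] assms by (simp add: n_subsets)
  finally show ?thesis using assms by simp
qed

text \<open>The left side is the eigenvalue at the character \<open>U\<close> of the adjacency matrix of the relation "at
  distance \<open>s\<close>"; so \<open>krawtchouk_min\<close> is the smallest of its eigenvalues divided by the degree.\<close>

lemma sum_chi_level_dual:
  assumes "U \<subseteq> {..<n}" "s \<le> n"
  shows "(\<Sum>W | W \<subseteq> {..<n} \<and> card W = s. chi U W) = real (n choose s) * krawtchouk n (card U) s"
proof -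
  have "card U \<le> n" using assms(1) card_mono[of "{..<n}" U] by simp
  then show ?thesis
    using sum_chi_level[OF assms] krawtchouk_commute[OF _ assms(2)] by (simp add: chi_commute[of U])
qed

lemma krawtchouk_min_le: "k \<le> n \<Longrightarrow> krawtchouk_min n s \<le> krawtchouk n k s"
  unfolding krawtchouk_min_def by (rule Min_le) auto

lemma krawtchouk_min_attained: obtains k where "k \<le> n" "krawtchouk_min n s = krawtchouk n k s"
proof -
  have "krawtchouk_min n s \<in> {krawtchouk n k s | k. k \<in> {0..n}}"
    unfolding krawtchouk_min_def by (rule Min_in) auto
  then show thesis using that by auto
qed

text \<open>The adjacency matrix of the relation "at distance \<open>s\<close>" has zero diagonal, so its eigenvalues add up
  to zero and the smallest one cannot be positive.\<close>

lemma krawtchouk_min_nonpos: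
  assumes "0 < s" "s \<le> n"
  shows "krawtchouk_min n s \<le> 0"
proof -
  let ?W = "{W. W \<subseteq> {..<n} \<and> card W = s}"
  have "2 ^ n * (real (n choose s) * krawtchouk_min n s)
      = (\<Sum>U\<in>Pow {..<n}. real (n choose s) * krawtchouk_min n s)"
    by (simp add: card_Pow)
  also have "\<dots> \<le> (\<Sum>U\<in>Pow {..<n}. real (n choose s) * krawtchouk n (card U) s)"
  proof (intro sum_mono mult_left_mono krawtchouk_min_le)
    fix U assume "U \<in> Pow {..<n}"
    then show "card U \<le> n" using card_mono[of "{..<n}" U] by simp
  qed simp
  also have "\<dots> = (\<Sum>U\<in>Pow {..<n}. \<Sum>W\<in>?W. chi U W)"
    using assms(2) by (intro sum.cong refl) (simp add: sum_chi_level_dual)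
  also have "\<dots> = (\<Sum>W\<in>?W. \<Sum>U\<in>Pow {..<n}. chi U W)"
    by (rule sum.swap)
  also have "\<dots> = 0"
    using assms(1) by (intro sum.neutral) (auto simp: sum_chi_Pow)
  finally have "\<not> 0 < 2 ^ n * (real (n choose s) * krawtchouk_min n s)" by simp
  then show ?thesis using assms(2) by (simp add: zero_less_mult_iff)
qed


section \<open>Isometries of the cube and links of the triangle hypergraph\<close>

lemma hdist_self [simp]: "hdist x x = 0"
  by (simp add: hdist_def)

text \<open>The sphere of radius \<open>s\<close> about \<open>x\<close>, which is the vertex set of the link of \<open>x\<close> under the
  conditions of \<open>link_verts_triangle\<close>.\<close>

definition level_at :: "nat \<Rightarrow> nat \<Rightarrow> word \<Rightarrow> word set" where
  "level_at n s x = {y \<in> cube n. hdist x y = s}"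

definition cube_isometry :: "nat \<Rightarrow> (word \<Rightarrow> word) \<Rightarrow> bool" where
  "cube_isometry n h \<longleftrightarrow> h ` cube n \<subseteq> cube n \<and> (\<forall>x\<in>cube n. \<forall>y\<in>cube n. hdist (h x) (h y) = hdist x y)"

lemma cube_isometry_bij:
  assumes "cube_isometry n h"
  shows "bij_betw h (cube n) (cube n)"
proof -
  have "x = y" if "x \<in> cube n" "y \<in> cube n" "h x = h y" for x y
  proof -
    have "h y \<in> cube n" "hdist (h x) (h y) = hdist x y"
      using assms that(1,2) by (auto simp: cube_isometry_def)
    then have "hdist x y = 0" using that(3) hdist_0_iff[of "h y" n "h y"] by simp
    then show ?thesis using hdist_0_iff[OF that(1,2)] by simp
  qed
  then have "inj_on h (cube n)" by (rule inj_onI)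
  moreover from this have "h ` cube n = cube n"
    using assms by (intro endo_inj_surj) (simp_all add: cube_isometry_def)
  ultimately show ?thesis by (simp add: bij_betw_def)
qed

lemma bij_betw_level_at:
  assumes h: "cube_isometry n h" and x: "x \<in> cube n"
  shows "bij_betw h (level_at n s x) (level_at n s (h x))"
proof -
  have bij: "bij_betw h (cube n) (cube n)" using h by (rule cube_isometry_bij)
  have d: "hdist (h x) (h y) = hdist x y" if "y \<in> cube n" for y
    using h x that by (simp add: cube_isometry_def)
  have "h ` level_at n s x = level_at n s (h x)"
  proof (intro set_eqI iffI)
    fix z assume z: "z \<in> level_at n s (h x)"
    then have "z \<in> h ` cube n" using bij by (simp add: bij_betw_def level_at_def)
    then show "z \<in> h ` level_at n s x" using z d by (auto simp: level_at_def)
  next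
    fix z assume "z \<in> h ` level_at n s x"
    then show "z \<in> level_at n s (h x)" using d bij_betw_apply[OF bij] by (auto simp: level_at_def)
  qed
  moreover have "inj_on h (level_at n s x)"
    using bij by (auto simp: bij_betw_def level_at_def intro: inj_on_subset)
  ultimately show ?thesis by (simp add: bij_betw_def)
qed

text \<open>Taking supports identifies the cube with the subsets of \<open>{..<n}\<close>, and there the isometries that matter
  here, shifts by a fixed set and permutations of the coordinates, have simple formulas.\<close>

lemma ex_cube_isometry:
  assumes "\<And>A. A \<subseteq> {..<n} \<Longrightarrow> \<phi> A \<subseteq> {..<n}"
    and "\<And>A B. A \<subseteq> {..<n} \<Longrightarrow> B \<subseteq> {..<n} \<Longrightarrow> card (sym_diff (\<phi> A) (\<phi> B)) = card (sym_diff A B)"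
  shows "\<exists>h. cube_isometry n h \<and> (\<forall>x\<in>cube n. supp (h x) = \<phi> (supp x))"
proof -
  have "\<forall>x\<in>cube n. \<exists>y. y \<in> cube n \<and> supp y = \<phi> (supp x)"
    using assms(1) supp_subset ex_word_supp by metis
  then obtain h where h: "\<And>x. x \<in> cube n \<Longrightarrow> h x \<in> cube n \<and> supp (h x) = \<phi> (supp x)"
    by metis
  then have "cube_isometry n h"
    using assms(2)[OF supp_subset supp_subset] by (auto simp: cube_isometry_def hdist_eq[of _ n])
  with h show ?thesis by blast
qed

lemma zero_word_in_cube [simp]: "zero_word n \<in> cube n"
  by (simp add: zero_word_def cube_def)

lemma supp_zero_word [simp]: "supp (zero_word n) = {}"
  by (auto simp: zero_word_def supp_def)

lemma level_at_zero_word: "level_at n s (zero_word n) = cube_level n s"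
  using hdist_eq[OF zero_word_in_cube, of _ n] by (auto simp: level_at_def cube_level_def weight_eq)

lemma translation_to_zero:
  assumes "x \<in> cube n"
  obtains h where "cube_isometry n h" "h x = zero_word n"
proof -
  let ?\<phi> = "\<lambda>A. sym_diff A (supp x)"
  have sub: "?\<phi> A \<subseteq> {..<n}" if "A \<subseteq> {..<n}" for A
    using that supp_subset[OF assms] by auto
  have "sym_diff (?\<phi> A) (?\<phi> B) = sym_diff A B" for A B by auto
  then have "card (sym_diff (?\<phi> A) (?\<phi> B)) = card (sym_diff A B)" for A B by simp
  with sub have "\<exists>h. cube_isometry n h \<and> (\<forall>y\<in>cube n. supp (h y) = ?\<phi> (supp y))"
    by (intro ex_cube_isometry[of n ?\<phi>])
  then obtain h where h: "cube_isometry n h" "\<forall>y\<in>cube n. supp (h y) = ?\<phi> (supp y)"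
    by blast
  have "supp (h x) = supp (zero_word n)" using h(2) assms by simp
  moreover have "h x \<in> cube n" using h(1) assms by (auto simp: cube_isometry_def)
  ultimately have "h x = zero_word n" using supp_inj[OF _ zero_word_in_cube] by blast
  with h(1) show thesis using that by blast
qed

text \<open>Two supports of the same size are matched by a permutation of the coordinates, glued from a
  bijection between the supports and one between their complements.\<close>

lemma rotation_within_level:
  assumes "y \<in> cube_level n s" "z \<in> cube_level n s"
  obtains h where "cube_isometry n h" "h (zero_word n) = zero_word n" "h y = z"
proof -
  have y: "y \<in> cube n" "card (supp y) = s" and z: "z \<in> cube n" "card (supp z) = s"
    using assms by (auto simp: cube_level_def weight_eq)
  note sub = supp_subset[OF y(1)] supp_subset[OF z(1)]
  obtain f where f: "bij_betw f (supp y) (supp z)"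
    using y(2) z(2) finite_same_card_bij[of "supp y" "supp z"] by auto
  obtain g where g: "bij_betw g ({..<n} - supp y) ({..<n} - supp z)"
    using y(2) z(2) sub finite_same_card_bij[of "{..<n} - supp y" "{..<n} - supp z"]
    by (auto simp: card_Diff_subset)
  define p where "p = (\<lambda>i. if i \<in> supp y then f i else g i)"
  have py: "bij_betw p (supp y) (supp z)"
    using f by (subst bij_betw_cong[of _ p f]) (auto simp: p_def)
  have "bij_betw p ({..<n} - supp y) ({..<n} - supp z)"
    using g by (subst bij_betw_cong[of _ p g]) (auto simp: p_def)
  from bij_betw_combine[OF py this] sub have p: "bij_betw p {..<n} {..<n}"
    by (simp add: Un_absorb1)
  have inj: "inj_on p {..<n}" using p by (simp add: bij_betw_def)
  have sub_p: "p ` A \<subseteq> {..<n}" if "A \<subseteq> {..<n}" for A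
    using that p by (auto simp: bij_betw_def)
  have card_p: "card (sym_diff (p ` A) (p ` B)) = card (sym_diff A B)"
    if AB: "A \<subseteq> {..<n}" "B \<subseteq> {..<n}" for A B
  proof -
    have "p ` (A - B) = p ` A - p ` B" "p ` (B - A) = p ` B - p ` A"
      using AB by (intro inj_on_image_set_diff[OF inj]; blast)+
    then have "sym_diff (p ` A) (p ` B) = p ` sym_diff A B" by (simp add: image_Un)
    moreover have "inj_on p (sym_diff A B)"
      using AB by (intro inj_on_subset[OF inj]) auto
    ultimately show ?thesis by (simp add: card_image)
  qed
  have "\<exists>h. cube_isometry n h \<and> (\<forall>x\<in>cube n. supp (h x) = p ` supp x)"
    by (rule ex_cube_isometry[of n "image p"]) (erule sub_p, erule (1) card_p)
  then obtain h where h: "cube_isometry n h" "\<forall>x\<in>cube n. supp (h x) = p ` supp x" by blast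
  have cube: "h y \<in> cube n" "h (zero_word n) \<in> cube n"
    using h(1) y(1) by (auto simp: cube_isometry_def)
  have "supp (h y) = supp z" using h(2) y(1) py by (simp add: bij_betw_def)
  then have "h y = z" using supp_inj[OF cube(1) z(1)] by simp
  moreover have "h (zero_word n) = zero_word n"
    using h(2) supp_inj[OF cube(2) zero_word_in_cube] by simp
  ultimately show thesis using that h(1) by blast
qed

lemma card_level_at:
  assumes "x \<in> cube n"
  shows "card (level_at n s x) = n choose s"
proof -
  obtain h where h: "cube_isometry n h" "h x = zero_word n" using translation_to_zero[OF assms] .
  have "bij_betw h (level_at n s x) (level_at n s (h x))" by (rule bij_betw_level_at[OF h(1) assms])
  then show ?thesis by (simp add: h(2) level_at_zero_word bij_betw_same_card card_cube_level)
qed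

text \<open>Starting from \<open>x\<close>, flip half of the \<open>s\<close> positions in which \<open>x\<close> and \<open>y\<close> differ and \<open>s / 2\<close> of the
  \<open>n - s\<close> positions in which they agree; the bound on \<open>s\<close> says exactly that there are enough of the
  latter.\<close>

lemma ex_triangle:
  assumes "even s" "s \<le> (2 * n) div 3" "x \<in> cube n" "y \<in> level_at n s x"
  obtains z where "z \<in> level_at n s x" "hdist y z = s"
proof -
  let ?D = "sym_diff (supp x) (supp y)"
  have y: "y \<in> cube n" "card ?D = s" using assms by (auto simp: level_at_def hdist_eq)
  note sub = supp_subset[OF assms(3)] supp_subset[OF y(1)]
  obtain t where t: "s = 2 * t" using assms(1) by (auto elim: evenE)
  have "card ({..<n} - ?D) = n - s" using sub y(2) by (subst card_Diff_subset) auto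
  moreover have "t \<le> n - s" using assms(2) t by linarith
  ultimately obtain B where B: "B \<subseteq> {..<n} - ?D" "card B = t" "finite B"
    using obtain_subset_with_card_n by metis
  obtain A where A: "A \<subseteq> ?D" "card A = t" "finite A"
    using obtain_subset_with_card_n[of t ?D] y(2) t by auto
  have "sym_diff (supp x) (A \<union> B) \<subseteq> {..<n}" using A B sub by auto
  then obtain z where z: "z \<in> cube n" "supp z = sym_diff (supp x) (A \<union> B)" by (rule ex_word_supp)
  have "sym_diff (supp x) (supp z) = A \<union> B" by (auto simp: z(2))
  moreover have "card (A \<union> B) = s" using A B t by (subst card_Un_disjoint) auto
  ultimately have "hdist x z = s" by (simp add: hdist_eq[OF assms(3) z(1)])
  moreover have "hdist y z = s"
  proof -
    have "sym_diff (supp y) (supp z) = (?D - A) \<union> B" using A(1) B(1) by (auto simp: z(2))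
    moreover have "card ((?D - A) \<union> B) = card (?D - A) + card B"
      using A B by (intro card_Un_disjoint) auto
    moreover have "card (?D - A) = t" using A y(2) t by (simp add: card_Diff_subset)
    ultimately show ?thesis using B(2) t by (simp add: hdist_eq[OF y(1) z(1)])
  qed
  ultimately show thesis using that z(1) by (simp add: level_at_def)
qed

lemma triangle_edge_iff:
  assumes "0 < s"
  shows "{x, y, z} \<in> edges (triangle_hypergraph n s) \<longleftrightarrow>
    x \<in> cube n \<and> y \<in> level_at n s x \<and> z \<in> level_at n s x \<and> hdist y z = s"
proof
  assume R: "x \<in> cube n \<and> y \<in> level_at n s x \<and> z \<in> level_at n s x \<and> hdist y z = s"
  then have "x \<noteq> y" "x \<noteq> z" "y \<noteq> z" using assms by (auto simp: level_at_def)
  with R show "{x, y, z} \<in> edges (triangle_hypergraph n s)"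
    by (auto simp: triangle_hypergraph_def level_at_def)
next
  assume L: "{x, y, z} \<in> edges (triangle_hypergraph n s)"
  then have "card {x, y, z} = 3"
    using uniform_triangle_hypergraph[of n s] unfolding uniform_def by blast
  then have ne: "x \<noteq> y" "x \<noteq> z" "y \<noteq> z" by (auto simp: card_insert_if split: if_splits)
  obtain a b c where abc: "{x, y, z} = {a, b, c}" "a \<in> cube n" "b \<in> cube n" "c \<in> cube n"
    "hdist a b = s" "hdist a c = s" "hdist b c = s"
    using L by (auto simp: triangle_hypergraph_def)
  have pair: "u \<in> cube n \<and> v \<in> cube n \<and> hdist u v = s" if "u \<in> {a, b, c}" "v \<in> {a, b, c}" "u \<noteq> v" for u v
    using that abc hdist_commute by auto
  show "x \<in> cube n \<and> y \<in> level_at n s x \<and> z \<in> level_at n s x \<and> hdist y z = s"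
    using pair[of x y] pair[of x z] pair[of y z] ne by (simp add: level_at_def flip: abc(1))
qed

lemma link_verts_triangle:
  assumes "even s" "0 < s" "s \<le> (2 * n) div 3" "x \<in> cube n"
  shows "link_verts (triangle_hypergraph n s) x = level_at n s x"
proof (intro set_eqI iffI)
  fix y assume "y \<in> link_verts (triangle_hypergraph n s) x"
  then obtain e where e: "e \<in> edges (triangle_hypergraph n s)" "x \<in> e" "y \<in> e" "y \<noteq> x"
    by (auto simp: link_verts_def)
  have "card e = 3" using e(1) uniform_triangle_hypergraph[of n s] by (auto simp: uniform_def)
  then have "card (e - {x, y}) = 1" using e by (subst card_Diff_subset) auto
  then obtain z where "e - {x, y} = {z}" by (rule card_1_singletonE)
  then have "e = {x, y, z}" using e by auto
  with e(1) show "y \<in> level_at n s x" using triangle_edge_iff[OF assms(2)] by simp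
next
  fix y assume y: "y \<in> level_at n s x"
  obtain z where "z \<in> level_at n s x" "hdist y z = s"
    using ex_triangle[OF assms(1,3,4) y] .
  then have "{x, y, z} \<in> edges (triangle_hypergraph n s)"
    using assms(4) y by (simp add: triangle_edge_iff[OF assms(2)])
  moreover have "y \<noteq> x" "y \<in> cube n" using y assms(2) by (auto simp: level_at_def)
  ultimately show "y \<in> link_verts (triangle_hypergraph n s) x"
    by (auto simp: link_verts_def triangle_hypergraph_def)
qed

lemma link_triangle_edge_iff:
  assumes "even s" "0 < s" "s \<le> (2 * n) div 3" "x \<in> cube n" "y \<in> level_at n s x" "z \<in> level_at n s x"
  shows "{y, z} \<in> edges (link (triangle_hypergraph n s) x) \<longleftrightarrow> hdist y z = s"
  using assms(4-6) by (simp add: link_def link_verts_triangle[OF assms(1-4)] triangle_edge_iff[OF assms(2)])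

lemma graph_iso_link_triangle:
  assumes s: "even s" "0 < s" "s \<le> (2 * n) div 3" and x: "x \<in> cube n" and h: "cube_isometry n h"
  shows "graph_iso h (link (triangle_hypergraph n s) x) (link (triangle_hypergraph n s) (h x))"
proof -
  have hx: "h x \<in> cube n" using h x by (auto simp: cube_isometry_def)
  have verts: "verts (link (triangle_hypergraph n s) y) = level_at n s y" if "y \<in> cube n" for y
    using link_verts_triangle[OF s that] by (simp add: link_def)
  have bij: "bij_betw h (level_at n s x) (level_at n s (h x))" by (rule bij_betw_level_at[OF h x])
  show ?thesis
    unfolding graph_iso_def verts[OF x] verts[OF hx]
  proof (intro conjI ballI bij)
    fix y z assume yz: "y \<in> level_at n s x" "z \<in> level_at n s x"
    note h_yz = bij_betw_apply[OF bij yz(1)] bij_betw_apply[OF bij yz(2)]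
    have "hdist (h y) (h z) = hdist y z"
      using h yz by (simp add: cube_isometry_def level_at_def)
    then show "({y, z} \<in> edges (link (triangle_hypergraph n s) x))
        = ({h y, h z} \<in> edges (link (triangle_hypergraph n s) (h x)))"
      by (simp add: link_triangle_edge_iff[OF s x yz] link_triangle_edge_iff[OF s hx h_yz])
  qed
qed


section \<open>Invariant matrices on the cube\<close>

text \<open>The entries of \<open>F\<close> at distance \<open>s\<close> add up to the inner product of \<open>F\<close> with the adjacency matrix of
  that relation. Let \<open>q U\<close> be the value of the form \<open>F\<close> at the character \<open>U\<close>. Expanding the adjacency
  matrix in characters turns \<open>2 ^ n\<close> times the inner product into a combination of the nonnegative
  numbers \<open>q U\<close>, with the eigenvalues as coefficients. The trivial character has the
  coefficient \<open>n choose s\<close>, and \<open>q {} \<ge> T\<^sup>2\<close> because of the border of \<open>R(F)\<close>; every other coefficient is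
  at least \<open>(n choose s) * krawtchouk_min n s\<close>, and all the \<open>q U\<close> together add up to \<open>2 ^ n * T\<close>.\<close>

lemma sum_over_distance_le:
  assumes F: "theta_matrix (cube n) F" and s: "0 < s" "s \<le> n"
  defines "T \<equiv> \<Sum>x\<in>cube n. F x x"
  shows "real (n choose s) * (T\<^sup>2 * (1 - krawtchouk_min n s) + 2 ^ n * T * krawtchouk_min n s)
    \<le> 2 ^ n * (\<Sum>x\<in>cube n. \<Sum>y\<in>level_at n s x. F x y)"
proof -
  let ?N = "{..<n}"
  let ?M = "krawtchouk_min n s"
  define c where "c U x = chi U (supp x)" for U x
  define q where "q U = (\<Sum>x\<in>cube n. \<Sum>y\<in>cube n. c U x * F x y * c U y)" for U
  have q_nonneg: "0 \<le> q U" for U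
    using theta_matrixD[OF F, of 0 "c U"] by (simp add: q_def)
  \<comment> \<open>The form at \<open>c = 1\<close> is \<open>t\<^sup>2 + 2 * t * T + q {}\<close>, which is smallest at \<open>t = - T\<close>.\<close>
  have q_empty: "T\<^sup>2 \<le> q {}"
    using theta_matrixD[OF F, of "- T" "\<lambda>_. 1"] by (simp add: q_def c_def T_def power2_eq_square)
  have q_sum: "(\<Sum>U\<in>Pow ?N. e U * q U)
      = (\<Sum>x\<in>cube n. \<Sum>y\<in>cube n. (\<Sum>U\<in>Pow ?N. e U * chi U (sym_diff (supp x) (supp y))) * F x y)" for e
  proof -
    have "(\<Sum>U\<in>Pow ?N. e U * q U)
        = (\<Sum>U\<in>Pow ?N. \<Sum>x\<in>cube n. \<Sum>y\<in>cube n. e U * chi U (sym_diff (supp x) (supp y)) * F x y)"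
      by (simp add: q_def c_def sum_distrib_left chi_mult[symmetric] ac_simps)
    also have "\<dots> = (\<Sum>x\<in>cube n. \<Sum>y\<in>cube n. \<Sum>U\<in>Pow ?N. e U * chi U (sym_diff (supp x) (supp y)) * F x y)"
      by (subst sum.swap) (intro sum.cong refl sum.swap)
    finally show ?thesis by (simp add: sum_distrib_right)
  qed
  have sub: "sym_diff (supp x) (supp y) \<subseteq> ?N" if "x \<in> cube n" "y \<in> cube n" for x y
    using supp_subset that by blast
  have "(\<Sum>U\<in>Pow ?N. q U) = (\<Sum>x\<in>cube n. \<Sum>y\<in>cube n. (if x = y then 2 ^ n else 0) * F x y)"
  proof -
    have "(\<Sum>U\<in>Pow ?N. chi U (sym_diff (supp x) (supp y))) = (if x = y then 2 ^ n else 0)"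
      if "x \<in> cube n" "y \<in> cube n" for x y
      using sum_chi_Pow[of ?N, OF _ sub[OF that]] supp_inj[OF that] by auto
    then show ?thesis using q_sum[of "\<lambda>_. 1"] by simp
  qed
  also have "\<dots> = (\<Sum>x\<in>cube n. \<Sum>y\<in>cube n. if x = y then 2 ^ n * F x y else 0)"
    by (intro sum.cong refl) auto
  finally have q_total: "(\<Sum>U\<in>Pow ?N. q U) = 2 ^ n * T"
    by (simp add: T_def sum_distrib_left)
  have coeff: "(\<Sum>U\<in>Pow ?N. (real (n choose s) * krawtchouk n (card U) s) * chi U D)
      = (if card D = s then 2 ^ n else 0)" if D: "D \<subseteq> ?N" for D
  proof -
    let ?W = "{W. W \<subseteq> ?N \<and> card W = s}"
    have finD: "finite D" using D finite_subset by blast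
    have "(\<Sum>U\<in>Pow ?N. (real (n choose s) * krawtchouk n (card U) s) * chi U D)
        = (\<Sum>U\<in>Pow ?N. \<Sum>W\<in>?W. chi U W * chi U D)"
      using s(2) by (intro sum.cong refl) (simp add: sum_chi_level_dual[symmetric] sum_distrib_right)
    also have "\<dots> = (\<Sum>U\<in>Pow ?N. \<Sum>W\<in>?W. chi U (sym_diff W D))"
      using finD by (intro sum.cong refl chi_mult) (auto intro: finite_subset)
    also have "\<dots> = (\<Sum>W\<in>?W. \<Sum>U\<in>Pow ?N. chi U (sym_diff W D))"
      by (rule sum.swap)
    also have "\<dots> = (\<Sum>W\<in>?W. if W = D then 2 ^ n else 0)"
    proof (intro sum.cong refl)
      fix W assume "W \<in> ?W"
      then have "sym_diff W D \<subseteq> ?N" using D by auto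
      moreover have "sym_diff W D = {} \<longleftrightarrow> W = D" by auto
      ultimately show "(\<Sum>U\<in>Pow ?N. chi U (sym_diff W D)) = (if W = D then 2 ^ n else 0)"
        by (simp add: sum_chi_Pow)
    qed
    also have "\<dots> = (if card D = s then 2 ^ n else 0)" using D by simp
    finally show ?thesis .
  qed
  have "(\<Sum>U\<in>Pow ?N. (real (n choose s) * krawtchouk n (card U) s) * q U)
      = (\<Sum>x\<in>cube n. \<Sum>y\<in>cube n. (if hdist x y = s then 2 ^ n else 0) * F x y)"
    unfolding q_sum using sub by (intro sum.cong refl) (simp add: coeff hdist_eq[of _ n])
  also have "\<dots> = (\<Sum>x\<in>cube n. \<Sum>y\<in>level_at n s x. 2 ^ n * F x y)"
    unfolding level_at_def by (subst sum.inter_filter) (auto intro!: sum.cong)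
  finally have spectral: "(\<Sum>U\<in>Pow ?N. (real (n choose s) * krawtchouk n (card U) s) * q U)
      = 2 ^ n * (\<Sum>x\<in>cube n. \<Sum>y\<in>level_at n s x. F x y)"
    by (simp add: sum_distrib_left)
  have low: "?M * q U \<le> krawtchouk n (card U) s * q U" if "U \<in> Pow ?N" for U
    using that card_mono[of ?N U] by (intro mult_right_mono krawtchouk_min_le q_nonneg) auto
  have "(1 - ?M) * T\<^sup>2 + ?M * (2 ^ n * T) \<le> (1 - ?M) * q {} + ?M * (\<Sum>U\<in>Pow ?N. q U)"
    using q_empty krawtchouk_min_nonpos[OF s] by (simp add: q_total mult_left_mono)
  also have "\<dots> = q {} + (\<Sum>U\<in>Pow ?N - {{}}. ?M * q U)"
    by (simp add: sum.remove[of "Pow ?N" "{}"] sum_distrib_left algebra_simps)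
  also have "\<dots> \<le> q {} + (\<Sum>U\<in>Pow ?N - {{}}. krawtchouk n (card U) s * q U)"
    using low by (intro add_left_mono sum_mono) auto
  also have "\<dots> = (\<Sum>U\<in>Pow ?N. krawtchouk n (card U) s * q U)"
    by (simp add: sum.remove[of "Pow ?N" "{}"] krawtchouk_def)
  finally have "real (n choose s) * ((1 - ?M) * T\<^sup>2 + ?M * (2 ^ n * T))
      \<le> real (n choose s) * (\<Sum>U\<in>Pow ?N. krawtchouk n (card U) s * q U)"
    by (rule mult_left_mono) simp
  then show ?thesis
    using spectral by (simp add: sum_distrib_left ac_simps)
qed

lemma krawtchouk_0:
  assumes "k \<le> n"
  shows "krawtchouk n k 0 = 1"
proof -
  have "{0..k} = insert 0 {Suc 0..k}" by auto
  moreover have "(\<Sum>i=Suc 0..k. (-1) ^ i * real (0 choose i) * real (n choose (k - i))) = 0"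
    by (intro sum.neutral) auto
  ultimately show ?thesis using assms by (simp add: krawtchouk_def)
qed

text \<open>By \<open>sum_chi_level\<close>, \<open>krawtchouk n k (hdist x y)\<close> is an average of the rank-one matrices
  \<open>chi U (supp x) * chi U (supp y)\<close>, and so positive semidefinite with unit diagonal. Adding the constant \<open>d\<^sup>2\<close>
  completes the square with the border: the form becomes \<open>(t + d * S)\<^sup>2\<close> plus \<open>d - d\<^sup>2\<close> times a
  nonnegative form.\<close>

lemma theta_matrix_krawtchouk:
  assumes "0 \<le> d" "d \<le> 1" "k \<le> n"
  shows "theta_matrix (cube n) (\<lambda>x y. d\<^sup>2 + (d - d\<^sup>2) * krawtchouk n k (hdist x y))"
proof -
  let ?L = "{U. U \<subseteq> {..<n} \<and> card U = k}"
  define K where "K x y = krawtchouk n k (hdist x y)" for x y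
  have K_refl: "K x x = 1" for x using assms(3) by (simp add: K_def krawtchouk_0)
  have K_chi: "real (n choose k) * K x y = (\<Sum>U\<in>?L. chi U (supp x) * chi U (supp y))"
    if "x \<in> cube n" "y \<in> cube n" for x y
  proof -
    have "sym_diff (supp x) (supp y) \<subseteq> {..<n}" using supp_subset that by blast
    from sum_chi_level[OF this assms(3)] show ?thesis
      by (simp add: K_def hdist_eq[OF that] chi_mult)
  qed
  have K_nonneg: "0 \<le> (\<Sum>x\<in>cube n. \<Sum>y\<in>cube n. c x * K x y * c y)" for c
  proof -
    have "real (n choose k) * (\<Sum>x\<in>cube n. \<Sum>y\<in>cube n. c x * K x y * c y)
        = (\<Sum>x\<in>cube n. \<Sum>y\<in>cube n. c x * (real (n choose k) * K x y) * c y)"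
      by (simp add: sum_distrib_left ac_simps)
    also have "\<dots> = (\<Sum>x\<in>cube n. \<Sum>y\<in>cube n. \<Sum>U\<in>?L. (c x * chi U (supp x)) * (c y * chi U (supp y)))"
      by (intro sum.cong refl, subst K_chi) (simp_all add: sum_distrib_left sum_distrib_right ac_simps)
    also have "\<dots> = (\<Sum>U\<in>?L. \<Sum>x\<in>cube n. \<Sum>y\<in>cube n. (c x * chi U (supp x)) * (c y * chi U (supp y)))"
      by (subst sum.swap[of _ ?L]) (intro sum.cong refl sum.swap)
    also have "\<dots> = (\<Sum>U\<in>?L. (\<Sum>x\<in>cube n. c x * chi U (supp x))\<^sup>2)"
      by (simp add: power2_eq_square sum_product)
    finally have "0 \<le> real (n choose k) * (\<Sum>x\<in>cube n. \<Sum>y\<in>cube n. c x * K x y * c y)"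
      by (simp add: sum_nonneg)
    then show ?thesis using assms(3) by (simp add: zero_le_mult_iff)
  qed
  show ?thesis
    unfolding theta_matrix_def K_def[symmetric]
  proof (intro conjI allI ballI)
    fix x y assume "x \<in> cube n" "y \<in> cube n"
    then show "d\<^sup>2 + (d - d\<^sup>2) * K x y = d\<^sup>2 + (d - d\<^sup>2) * K y x"
      by (simp add: K_def hdist_commute)
  next
    fix t and c :: "word \<Rightarrow> real"
    define S where "S = (\<Sum>x\<in>cube n. c x)"
    define Q where "Q = (\<Sum>x\<in>cube n. \<Sum>y\<in>cube n. c x * K x y * c y)"
    have "(\<Sum>x\<in>cube n. \<Sum>y\<in>cube n. c x * (d\<^sup>2 + (d - d\<^sup>2) * K x y) * c y)
        = (\<Sum>x\<in>cube n. \<Sum>y\<in>cube n. d\<^sup>2 * (c x * c y) + (d - d\<^sup>2) * (c x * K x y * c y))"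
      by (simp add: algebra_simps)
    also have "\<dots> = d\<^sup>2 * S\<^sup>2 + (d - d\<^sup>2) * Q"
      by (simp add: S_def Q_def sum.distrib power2_eq_square sum_product flip: sum_distrib_left)
    finally have 1: "(\<Sum>x\<in>cube n. \<Sum>y\<in>cube n. c x * (d\<^sup>2 + (d - d\<^sup>2) * K x y) * c y) = \<dots>" .
    have 2: "(\<Sum>x\<in>cube n. c x * (d\<^sup>2 + (d - d\<^sup>2) * K x x)) = d * S"
      by (simp add: K_refl S_def mult.commute[of _ d] flip: sum_distrib_left)
    have "0 \<le> d * (1 - d)" using assms by (intro mult_nonneg_nonneg) auto
    then have "0 \<le> d - d\<^sup>2" by (simp add: power2_eq_square algebra_simps)
    then have "0 \<le> (d - d\<^sup>2) * Q"
      unfolding Q_def by (rule mult_nonneg_nonneg[OF _ K_nonneg])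
    moreover have "0 \<le> (t + d * S)\<^sup>2" by simp
    ultimately show "0 \<le> t\<^sup>2 + 2 * t * (\<Sum>x\<in>cube n. c x * (d\<^sup>2 + (d - d\<^sup>2) * K x x))
        + (\<Sum>x\<in>cube n. \<Sum>y\<in>cube n. c x * (d\<^sup>2 + (d - d\<^sup>2) * K x y) * c y)"
      unfolding 1 2 by (simp add: power2_eq_square algebra_simps)
  qed
qed


section \<open>The theta number of the triangle hypergraph\<close>

lemma verts_link_triangle:
  assumes "even s" "0 < s" "s \<le> (2 * n) div 3" "x \<in> cube n"
  shows "verts (link (triangle_hypergraph n s) x) = level_at n s x"
  using link_verts_triangle[OF assms] by (simp add: link_def)

lemma uniform_2_link_triangle: "uniform 2 (link (triangle_hypergraph n s) x)"
  using uniform_link[OF uniform_triangle_hypergraph] by simp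

lemma theta_link_triangle:
  assumes s: "even s" "0 < s" "s \<le> (2 * n) div 3" and x: "x \<in> cube n"
  shows "theta 2 (link (triangle_hypergraph n s) x) = theta 2 (link (triangle_hypergraph n s) (zero_word n))"
proof -
  obtain h where h: "cube_isometry n h" "h x = zero_word n" using translation_to_zero[OF x] .
  show ?thesis
    using theta_2_iso[OF uniform_2_link_triangle uniform_2_link_triangle graph_iso_link_triangle[OF s x h(1)]]
    by (simp add: h(2))
qed

text \<open>Coordinate permutations fix the zero word and act transitively on a level, so \<open>constant_in_TH_2\<close> applies
  to the link of the zero word; a translation carries the result to the link of \<open>x\<close>.\<close>

lemma constant_in_TH_link_triangle:
  assumes s: "even s" "0 < s" "s \<le> (2 * n) div 3" and x: "x \<in> cube n"
  shows "restr (\<lambda>_. theta 2 (link (triangle_hypergraph n s) x) / (n choose s)) (level_at n s x)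
    \<in> TH 2 (link (triangle_hypergraph n s) x)"
proof -
  let ?G = "link (triangle_hypergraph n s)"
  let ?o = "zero_word n"
  note V = verts_link_triangle[OF s]
  have card0: "card (level_at n s ?o) = n choose s" by (simp add: card_level_at)
  have "restr (\<lambda>_. theta 2 (?G ?o) / card (verts (?G ?o))) (verts (?G ?o)) \<in> TH 2 (?G ?o)"
  proof (intro constant_in_TH_2 uniform_2_link_triangle)
    fix y z assume "y \<in> verts (?G ?o)" "z \<in> verts (?G ?o)"
    then have "y \<in> cube_level n s" "z \<in> cube_level n s" by (simp_all add: V level_at_zero_word)
    then obtain h where h: "cube_isometry n h" "h ?o = ?o" "h y = z" by (rule rotation_within_level)
    then show "\<exists>h. graph_iso h (?G ?o) (?G ?o) \<and> h y = z"
      using graph_iso_link_triangle[OF s zero_word_in_cube h(1)] by auto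
  qed
  then have 0: "restr (\<lambda>_. theta 2 (?G ?o) / (n choose s)) (level_at n s ?o) \<in> TH 2 (?G ?o)"
    by (simp add: V card0)
  obtain h where h: "cube_isometry n h" "h x = ?o" using translation_to_zero[OF x] .
  have iso: "graph_iso h (?G x) (?G ?o)" using graph_iso_link_triangle[OF s x h(1)] by (simp add: h(2))
  have "h y \<in> level_at n s ?o" if "y \<in> level_at n s x" for y
    using bij_betw_apply[OF bij_betw_level_at[OF h(1) x] that] by (simp add: h(2))
  then have "restr (restr (\<lambda>_. theta 2 (?G ?o) / (n choose s)) (level_at n s ?o) \<circ> h) (level_at n s x)
      = restr (\<lambda>_. theta 2 (?G x) / (n choose s)) (level_at n s x)"
    by (auto simp: restr_def theta_link_triangle[OF s x])
  with TH_2_reindex[OF uniform_2_link_triangle uniform_2_link_triangle iso 0] show ?thesis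
    by (simp add: V[OF x])
qed

lemma TH_3_iff:
  assumes "finite (verts H)"
  shows "f \<in> TH 3 H \<longleftrightarrow> (\<exists>F. f = restr (\<lambda>x. F x x) (verts H) \<and>
     (\<forall>x\<in>verts H. link_verts H x \<noteq> {} \<longrightarrow>
        (\<exists>g\<in>TH 2 (link H x). restr (F x) (link_verts H x) = (\<lambda>y. F x x * g y))) \<and>
     theta_matrix (verts H) F)"
  by (simp add: numeral_3_eq_3 numeral_2_eq_2 image_iff psd_on_bordered_iff[OF assms])

theorem theorem7p1:
  fixes n s :: nat
  assumes "n \<ge> 1" and "even s" and "0 < s" and "s \<le> (2 * n) div 3"
  shows "theta 3 (triangle_hypergraph n s) =
    2 ^ n * ((krawtchouk_min n s
               - inverse (real (card (cube_level n s)))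
                 * theta 2 (link (triangle_hypergraph n s) (zero_word n)))
             / (krawtchouk_min n s - 1))"
proof -
  let ?H = "triangle_hypergraph n s"
  define M where "M = krawtchouk_min n s"
  define L where "L = real (n choose s)"
  define \<theta> where "\<theta> = theta 2 (link ?H (zero_word n))"
  \<comment> \<open>The optimal diagonal entry: the value for which \<open>d * (1 - M) + M\<close> equals \<open>\<theta> / L\<close>.\<close>
  define d where "d = (M - \<theta> / L) / (M - 1)"
  note s = assms(2-4)
  have "s \<le> n" using s(3) by linarith
  have M: "M \<le> 0" using krawtchouk_min_nonpos[OF s(2) \<open>s \<le> n\<close>] by (simp add: M_def)
  have L: "L > 0" using \<open>s \<le> n\<close> by (simp add: L_def)
  have \<theta>: "0 \<le> \<theta>" "\<theta> \<le> L"
    using theta_2_nonneg[OF uniform_2_link_triangle, of n s "zero_word n"]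
      theta_2_le_card[OF uniform_2_link_triangle, of n s "zero_word n"]
    by (simp_all add: \<theta>_def L_def verts_link_triangle[OF s zero_word_in_cube] card_level_at)
  have d_alt: "d = (\<theta> / L - M) / (1 - M)"
    using minus_divide_divide[of "\<theta> / L - M" "1 - M"] by (simp add: d_def)
  then have d: "d * (1 - M) = \<theta> / L - M" using M by simp
  have "0 \<le> \<theta> / L" "\<theta> / L \<le> 1" using \<theta> L by simp_all
  then have d01: "0 \<le> d" "d \<le> 1" using M by (simp_all add: d_alt)
  have verts: "verts ?H = cube n" by (simp add: triangle_hypergraph_def)
  have TH3: "f \<in> TH 3 ?H \<longleftrightarrow> (\<exists>F. f = restr (\<lambda>x. F x x) (cube n) \<and>
      (\<forall>x\<in>cube n. \<exists>g\<in>TH 2 (link ?H x). restr (F x) (level_at n s x) = (\<lambda>y. F x x * g y)) \<and>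
      theta_matrix (cube n) F)" for f
  proof -
    have "level_at n s x \<noteq> {}" if "x \<in> cube n" for x
      using card_level_at[OF that, of s] \<open>s \<le> n\<close> by auto
    then show ?thesis
      using link_verts_triangle[OF s] by (simp add: TH_3_iff verts)
  qed
  obtain k where k: "k \<le> n" "M = krawtchouk n k s"
    using krawtchouk_min_attained unfolding M_def by blast
  define F where "F x y = d\<^sup>2 + (d - d\<^sup>2) * krawtchouk n k (hdist x y)" for x y
  have F_diag: "F x x = d" for x using k(1) by (simp add: F_def krawtchouk_0)
  define f where "f = restr (\<lambda>x. F x x) (cube n)"
  have "f \<in> TH 3 ?H"
    unfolding TH3
  proof (intro exI[of _ F] conjI ballI)
    show "theta_matrix (cube n) F"
      using theta_matrix_krawtchouk[OF d01 k(1)] by (simp add: F_def[abs_def])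
    fix x assume x: "x \<in> cube n"
    \<comment> \<open>The choice of \<open>k\<close> and \<open>d\<close> makes row \<open>x\<close> equal to \<open>d\<close> times the optimal constant vector of the link.\<close>
    have "d\<^sup>2 + (d - d\<^sup>2) * M = d * (d * (1 - M) + M)" by (simp add: power2_eq_square algebra_simps)
    also have "\<dots> = d * (\<theta> / L)" by (simp add: d)
    finally have "F x y = d * (\<theta> / L)" if "y \<in> level_at n s x" for y
      using that by (simp add: F_def level_at_def k(2))
    then have "restr (F x) (level_at n s x) = (\<lambda>y. F x x * restr (\<lambda>_. \<theta> / L) (level_at n s x) y)"
      by (auto simp: restr_def F_diag)
    moreover have "restr (\<lambda>_. \<theta> / L) (level_at n s x) \<in> TH 2 (link ?H x)"
      using constant_in_TH_link_triangle[OF s x] by (simp add: theta_link_triangle[OF s x] \<theta>_def L_def)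
    ultimately show "\<exists>g\<in>TH 2 (link ?H x). restr (F x) (level_at n s x) = (\<lambda>y. F x x * g y)"
      by blast
  qed (simp add: f_def)
  moreover have sum_f: "(\<Sum>x\<in>verts ?H. f x) = 2 ^ n * d"
    by (simp add: verts f_def restr_def F_diag card_cube)
  moreover have "(\<Sum>x\<in>verts ?H. g x) \<le> 2 ^ n * d" if g: "g \<in> TH 3 ?H" for g
  proof -
    obtain G where G: "g = restr (\<lambda>x. G x x) (cube n)" "theta_matrix (cube n) G"
      and row: "\<forall>x\<in>cube n. \<exists>h\<in>TH 2 (link ?H x). restr (G x) (level_at n s x) = (\<lambda>y. G x x * h y)"
      using g unfolding TH3 by blast
    define T where "T = (\<Sum>x\<in>cube n. G x x)"
    have row_sum: "(\<Sum>y\<in>level_at n s x. G x y) \<le> G x x * \<theta>" if x: "x \<in> cube n" for x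
    proof -
      obtain h where h: "h \<in> TH 2 (link ?H x)" "restr (G x) (level_at n s x) = (\<lambda>y. G x x * h y)"
        using row x by blast
      have "(\<Sum>y\<in>level_at n s x. G x y) = (\<Sum>y\<in>level_at n s x. restr (G x) (level_at n s x) y)"
        by (simp add: restr_def)
      also have "\<dots> = G x x * (\<Sum>y\<in>level_at n s x. h y)" by (simp add: h(2) sum_distrib_left)
      also have "\<dots> \<le> G x x * \<theta>"
        using sum_le_theta_2[OF uniform_2_link_triangle h(1)]
          theta_matrix_diag_bounds(1)[OF finite_cube G(2) x]
        by (simp add: verts_link_triangle[OF s x] theta_link_triangle[OF s x] \<theta>_def mult_left_mono)
      finally show ?thesis .
    qed
    have "L * (T\<^sup>2 * (1 - M) + 2 ^ n * T * M) \<le> 2 ^ n * (\<Sum>x\<in>cube n. \<Sum>y\<in>level_at n s x. G x y)"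
      using sum_over_distance_le[OF G(2) s(2) \<open>s \<le> n\<close>] by (simp add: L_def T_def M_def)
    also have "\<dots> \<le> 2 ^ n * (T * \<theta>)"
      using row_sum by (simp add: T_def sum_distrib_right sum_mono)
    finally have main: "T * (L * (T * (1 - M) + 2 ^ n * M)) \<le> T * (2 ^ n * \<theta>)"
      by (simp add: power2_eq_square algebra_simps)
    have "T \<ge> 0"
      unfolding T_def by (intro sum_nonneg theta_matrix_diag_bounds(1)[OF finite_cube G(2)])
    have "T \<le> 2 ^ n * d"
    proof (cases "T = 0")
      case False
      with \<open>T \<ge> 0\<close> main have "L * (T * (1 - M) + 2 ^ n * M) \<le> 2 ^ n * \<theta>" by simp
      then have "T * (1 - M) \<le> 2 ^ n * (\<theta> / L - M)" using L by (simp add: field_simps)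
      then have "T * (1 - M) \<le> (2 ^ n * d) * (1 - M)" by (simp add: d mult.assoc)
      then show ?thesis by (rule mult_right_le_imp_le) (use M in simp)
    qed (use d01 in simp)
    then show ?thesis by (simp add: verts G(1) restr_def T_def)
  qed
  ultimately have "theta 3 ?H = 2 ^ n * d"
    using theta_eqI[of f 3 ?H] by simp
  then show ?thesis
    by (simp add: d_def M_def \<theta>_def L_def card_cube_level divide_inverse mult.commute)
qed

end
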